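(* Let $\Gamma$ be a triangulation of a connected closed $2$-dimensional surface and $F$ a face of $\Gamma$. Then the $z$-monodromy $M_F$ is one of the following permutations of $\Omega(F)$: (M1) $M_F$ is the identity; (M2) $M_F=D_F$; (M3) $M_F=(-e_1,e_2,e_3)(-e_3,-e_2,e_1)$, where $(e_1,e_2,e_3)$ is one of the cycles of $D_F$; (M4) $M_F=(e_1,-e_2)(e_2,-e_1)$, where $(e_1,e_2,e_3)$ is one of the cycles of $D_F$ (and $e_3,-e_3$ are fixed points); (M5) $M_F=(D_F)^{-1}$; (M6) $M_F=(-e_1,e_2,e_3)(-e_3,-e_2,e_1)$, where $(e_1,e_2,e_3)$ is one of the cycles of $(D_F)^{-1}$; (M7) $M_F=(e_1,e_2)(-e_1,-e_2)$, where $(e_1,e_2,e_3)$ is one of the cycles of $D_F$ (and $e_3,-e_3$ are fixed points). Moreover, $\Gamma$ is locally $z$-knotted for $F$ if and only if one of the cases (M1)–(M4) holds.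
   Context: Let $\Gamma$ be a connected simple finite graph embedded in a connected closed $2$-dimensional surface such that every face (closure of a component of the complement) is a closed $2$-disc, every edge lies in exactly two distinct faces, two distinct faces meet in an edge, a vertex, or not at all, and every face has exactly three edges (a triangulation). Two distinct edges are adjacent if they share a vertex and lie in a common face. A zigzag is a sequence of edges $(e_i)_{i\in\mathbb N}$ with $e_i,e_{i+1}$ adjacent and the face containing $e_i,e_{i+1}$ distinct from the face containing $e_{i+1},e_{i+2}$, for all $i$; it is periodic and regarded as a cyclic sequence; it can be written as a cyclic sequence of vertices $v_1,\dots,v_n$ with $e_i$ joining $v_i,v_{i+1}$, so each passage of the zigzag through an edge has a direction (an oriented edge). A zigzag is determined by any two consecutive (oriented) edges; its reverse $Z^{-1}$ is also a zigzag. For a face $F$ with vertices $a,b,c$, let $\Omega(F)=\{ab,bc,ca,ac,cb,ba\}$ be its oriented edges ($xy$ goes from $x$ to $y$), and for $e=xy$ write $-e=yx$. Let $D_F=(ab,bc,ca)(ac,cb,ba)$, i.e. $D_F(xy)=yz$ for distinct $x,y,z$. The $z$-monodromy $M_F:\Omega(F)\to\Omega(F)$ is defined by: for $e\in\Omega(F)$ take $e_0\in\Omega(F)$ with $D_F(e_0)=e$, take the zigzag $Z$ containing the consecutive oriented edges $e_0,e$, and let $M_F(e)$ be the first element of $\Omega(F)$ (oriented edge of $F$ in the direction traversed) occurring in $Z$ after $e$. Let $\mathcal Z(F)$ be the set of all zigzags containing a consecutive pair $e,D_F(e)$ with $e\in\Omega(F)$. $\Gamma$ is locally $z$-knotted for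 $F$ if $|\mathcal Z(F)|=2$. *)

theory Defs
  imports "HOL-Analysis.Analysis" "HOL-Combinatorics.Cycles"
begin

text \<open>Closed means compact (without boundary). The Hausdorff property comes from the type class.\<close>

definition closed_surface :: "'a::t2_space set \<Rightarrow> bool" where
  "closed_surface S \<longleftrightarrow> compact S \<and>
     (\<forall>x\<in>S. \<exists>U W. openin (top_of_set S) U \<and> x \<in> U \<and> open W \<and> U homeomorphic (W :: (real ^ 2) set))"

text \<open>An embedded graph is given by its image: the vertices are points of the surface and the
  edges are subsets (arcs) of the surface. The ends of an edge \<open>e\<close> are the elements of \<open>e \<inter> verts \<Gamma>\<close>.\<close>

record 'a embedded_graph =
  surface :: "'a set"
  verts :: "'a set"
  edges :: "'a set set"

definition embedded_simple_graph :: "('a::t2_space) embedded_graph \<Rightarrow> bool" where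
  "embedded_simple_graph \<Gamma> \<longleftrightarrow>
     finite (verts \<Gamma>) \<and> verts \<Gamma> \<subseteq> surface \<Gamma> \<and>
     finite (edges \<Gamma>) \<and> \<Union>(edges \<Gamma>) \<subseteq> surface \<Gamma> \<and>
     (\<forall>e\<in>edges \<Gamma>. \<exists>\<gamma>. arc \<gamma> \<and> path_image \<gamma> = e \<and> e \<inter> verts \<Gamma> = {pathstart \<gamma>, pathfinish \<gamma>}) \<and>
     (\<forall>e\<in>edges \<Gamma>. \<forall>e'\<in>edges \<Gamma>. e \<noteq> e' \<longrightarrow> e \<inter> e' \<subseteq> verts \<Gamma>) \<and>
     (\<forall>e\<in>edges \<Gamma>. \<forall>e'\<in>edges \<Gamma>. e \<inter> verts \<Gamma> = e' \<inter> verts \<Gamma> \<longrightarrow> e = e')"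

definition joins :: "'a embedded_graph \<Rightarrow> 'a set \<Rightarrow> 'a \<Rightarrow> 'a \<Rightarrow> bool" where
  "joins \<Gamma> e x y \<longleftrightarrow> e \<in> edges \<Gamma> \<and> e \<inter> verts \<Gamma> = {x, y}"

definition connected_graph :: "'a embedded_graph \<Rightarrow> bool" where
  "connected_graph \<Gamma> \<longleftrightarrow> verts \<Gamma> \<noteq> {} \<and>
     (\<forall>x\<in>verts \<Gamma>. \<forall>y\<in>verts \<Gamma>. (x, y) \<in> {(u, w). \<exists>e. joins \<Gamma> e u w}\<^sup>*)"

definition faces :: "('a::t2_space) embedded_graph \<Rightarrow> 'a set set" where
  "faces \<Gamma> = closure ` components (surface \<Gamma> - (verts \<Gamma> \<union> \<Union>(edges \<Gamma>)))"

definition surface_triangulation :: "('a::t2_space) embedded_graph \<Rightarrow> bool" where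
  "surface_triangulation \<Gamma> \<longleftrightarrow>
     closed_surface (surface \<Gamma>) \<and> connected (surface \<Gamma>) \<and>
     embedded_simple_graph \<Gamma> \<and> connected_graph \<Gamma> \<and>
     (\<forall>F\<in>faces \<Gamma>. F homeomorphic cball (0 :: real ^ 2) 1) \<and>
     (\<forall>e\<in>edges \<Gamma>. card {F \<in> faces \<Gamma>. e \<subseteq> F} = 2) \<and>
     (\<forall>F\<in>faces \<Gamma>. \<forall>F'\<in>faces \<Gamma>. F \<noteq> F' \<longrightarrow>
        F \<inter> F' \<in> edges \<Gamma> \<or> (\<exists>v\<in>verts \<Gamma>. F \<inter> F' = {v}) \<or> F \<inter> F' = {}) \<and>
     (\<forall>F\<in>faces \<Gamma>. card {e \<in> edges \<Gamma>. e \<subseteq> F} = 3)"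

definition adjacent :: "('a::t2_space) embedded_graph \<Rightarrow> 'a set \<Rightarrow> 'a set \<Rightarrow> bool" where
  "adjacent \<Gamma> e e' \<longleftrightarrow> e \<in> edges \<Gamma> \<and> e' \<in> edges \<Gamma> \<and> e \<noteq> e' \<and>
     (\<exists>v\<in>verts \<Gamma>. v \<in> e \<and> v \<in> e') \<and> (\<exists>F\<in>faces \<Gamma>. e \<subseteq> F \<and> e' \<subseteq> F)"

text \<open>Zigzags are written as sequences of oriented edges, an oriented edge being the pair of its
  tail and its head. The requirement that each oriented edge starts where the previous one ends
  excludes sequences of edges that rotate around one vertex; without it a zigzag would not be
  determined by two consecutive edges.\<close>

definition zigzag_edges :: "('a::t2_space) embedded_graph \<Rightarrow> (nat \<Rightarrow> 'a set) \<Rightarrow> bool" where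
  "zigzag_edges \<Gamma> e \<longleftrightarrow>
     (\<forall>i. adjacent \<Gamma> (e i) (e (i + 1))) \<and>
     (\<forall>i. \<forall>F\<in>faces \<Gamma>. \<forall>F'\<in>faces \<Gamma>.
        e i \<union> e (i + 1) \<subseteq> F \<and> e (i + 1) \<union> e (i + 2) \<subseteq> F' \<longrightarrow> F \<noteq> F')"

definition zigzag :: "('a::t2_space) embedded_graph \<Rightarrow> (nat \<Rightarrow> 'a \<times> 'a) \<Rightarrow> bool" where
  "zigzag \<Gamma> Z \<longleftrightarrow> (\<exists>e v. zigzag_edges \<Gamma> e \<and>
     (\<forall>i. joins \<Gamma> (e i) (v i) (v (i + 1)) \<and> Z i = (v i, v (i + 1))))"

text \<open>A periodic sequence regarded as a cyclic sequence is the set of all its shifts.\<close>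

definition cyclic_seq :: "(nat \<Rightarrow> 'b) \<Rightarrow> (nat \<Rightarrow> 'b) set" where
  "cyclic_seq Z = {\<lambda>i. Z (i + k) | k. True}"

definition oriented_edges :: "'a embedded_graph \<Rightarrow> 'a set \<Rightarrow> ('a \<times> 'a) set" where
  "oriented_edges \<Gamma> F = {(x, y). \<exists>e. joins \<Gamma> e x y \<and> e \<subseteq> F}"

text \<open>Permutations of \<open>oriented_edges \<Gamma> F\<close> are represented, as in \<^const>\<open>permutes\<close>, by functions
  that are the identity elsewhere.\<close>

definition face_rotation :: "'a embedded_graph \<Rightarrow> 'a set \<Rightarrow> 'a \<times> 'a \<Rightarrow> 'a \<times> 'a" where
  "face_rotation \<Gamma> F = (\<lambda>(x, y).
     if (x, y) \<in> oriented_edges \<Gamma> F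
     then (y, THE z. z \<in> verts \<Gamma> \<inter> F \<and> z \<noteq> x \<and> z \<noteq> y) else (x, y))"

definition z_monodromy :: "('a::t2_space) embedded_graph \<Rightarrow> 'a set \<Rightarrow> 'a \<times> 'a \<Rightarrow> 'a \<times> 'a" where
  "z_monodromy \<Gamma> F e =
     (if e \<in> oriented_edges \<Gamma> F then
        let e\<^sub>0 = (THE e\<^sub>0. e\<^sub>0 \<in> oriented_edges \<Gamma> F \<and> face_rotation \<Gamma> F e\<^sub>0 = e);
            Z = (THE Z. zigzag \<Gamma> Z \<and> Z 0 = e\<^sub>0 \<and> Z 1 = e)
        in Z (LEAST k. k > 1 \<and> Z k \<in> oriented_edges \<Gamma> F)
      else e)"

definition face_zigzags :: "('a::t2_space) embedded_graph \<Rightarrow> 'a set \<Rightarrow> (nat \<Rightarrow> 'a \<times> 'a) set set" where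
  "face_zigzags \<Gamma> F = {cyclic_seq Z | Z. zigzag \<Gamma> Z \<and>
     (\<exists>i. \<exists>e\<in>oriented_edges \<Gamma> F. Z i = e \<and> Z (i + 1) = face_rotation \<Gamma> F e)}"

definition locally_z_knotted :: "('a::t2_space) embedded_graph \<Rightarrow> 'a set \<Rightarrow> bool" where
  "locally_z_knotted \<Gamma> F \<longleftrightarrow> card (face_zigzags \<Gamma> F) = 2"

definition cycle3_of :: "('b \<Rightarrow> 'b) \<Rightarrow> 'b \<Rightarrow> 'b \<Rightarrow> 'b \<Rightarrow> bool" where
  "cycle3_of p e\<^sub>1 e\<^sub>2 e\<^sub>3 \<longleftrightarrow> distinct [e\<^sub>1, e\<^sub>2, e\<^sub>3] \<and> p e\<^sub>1 = e\<^sub>2 \<and> p e\<^sub>2 = e\<^sub>3 \<and> p e\<^sub>3 = e\<^sub>1"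

text \<open>The cases below take the permutations \<open>D\<close> (rotation) and \<open>M\<close> (monodromy) as arguments;
  \<open>- e\<close> is \<^term>\<open>prod.swap e\<close>, and \<^term>\<open>cycle_of_list [a, b, c]\<close> is the cycle
  sending \<open>a\<close> to \<open>b\<close>, \<open>b\<close> to \<open>c\<close> and \<open>c\<close> to \<open>a\<close>.\<close>

definition M1 :: "('a \<times> 'a \<Rightarrow> 'a \<times> 'a) \<Rightarrow> ('a \<times> 'a \<Rightarrow> 'a \<times> 'a) \<Rightarrow> bool" where
  "M1 D M \<longleftrightarrow> M = id"

definition M2 :: "('a \<times> 'a \<Rightarrow> 'a \<times> 'a) \<Rightarrow> ('a \<times> 'a \<Rightarrow> 'a \<times> 'a) \<Rightarrow> bool" where
  "M2 D M \<longleftrightarrow> M = D"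

definition M3 :: "('a \<times> 'a \<Rightarrow> 'a \<times> 'a) \<Rightarrow> ('a \<times> 'a \<Rightarrow> 'a \<times> 'a) \<Rightarrow> bool" where
  "M3 D M \<longleftrightarrow> (\<exists>e\<^sub>1 e\<^sub>2 e\<^sub>3. cycle3_of D e\<^sub>1 e\<^sub>2 e\<^sub>3 \<and>
     M = cycle_of_list [prod.swap e\<^sub>1, e\<^sub>2, e\<^sub>3] \<circ> cycle_of_list [prod.swap e\<^sub>3, prod.swap e\<^sub>2, e\<^sub>1])"

definition M4 :: "('a \<times> 'a \<Rightarrow> 'a \<times> 'a) \<Rightarrow> ('a \<times> 'a \<Rightarrow> 'a \<times> 'a) \<Rightarrow> bool" where
  "M4 D M \<longleftrightarrow> (\<exists>e\<^sub>1 e\<^sub>2 e\<^sub>3. cycle3_of D e\<^sub>1 e\<^sub>2 e\<^sub>3 \<and>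
     M = cycle_of_list [e\<^sub>1, prod.swap e\<^sub>2] \<circ> cycle_of_list [e\<^sub>2, prod.swap e\<^sub>1])"

definition M5 :: "('a \<times> 'a \<Rightarrow> 'a \<times> 'a) \<Rightarrow> ('a \<times> 'a \<Rightarrow> 'a \<times> 'a) \<Rightarrow> bool" where
  "M5 D M \<longleftrightarrow> M = inv D"

definition M6 :: "('a \<times> 'a \<Rightarrow> 'a \<times> 'a) \<Rightarrow> ('a \<times> 'a \<Rightarrow> 'a \<times> 'a) \<Rightarrow> bool" where
  "M6 D M \<longleftrightarrow> (\<exists>e\<^sub>1 e\<^sub>2 e\<^sub>3. cycle3_of (inv D) e\<^sub>1 e\<^sub>2 e\<^sub>3 \<and>
     M = cycle_of_list [prod.swap e\<^sub>1, e\<^sub>2, e\<^sub>3] \<circ> cycle_of_list [prod.swap e\<^sub>3, prod.swap e\<^sub>2, e\<^sub>1])"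

definition M7 :: "('a \<times> 'a \<Rightarrow> 'a \<times> 'a) \<Rightarrow> ('a \<times> 'a \<Rightarrow> 'a \<times> 'a) \<Rightarrow> bool" where
  "M7 D M \<longleftrightarrow> (\<exists>e\<^sub>1 e\<^sub>2 e\<^sub>3. cycle3_of D e\<^sub>1 e\<^sub>2 e\<^sub>3 \<and>
     M = cycle_of_list [e\<^sub>1, e\<^sub>2] \<circ> cycle_of_list [prod.swap e\<^sub>1, prod.swap e\<^sub>2])"

end

theory Submission
  imports Defs
begin

text \<open>Write \<open>D\<close> and \<open>M\<close> for rotation and monodromy, and let \<open>P e\<close> be the oriented edge through which the
  zigzag that starts with \<open>e, D e\<close> enters \<open>F\<close> at its next visit, so that \<open>M \<circ> D = P\<close>. Reversing
  the piece of the zigzag between the two visits gives \<open>M (- M e) = - e\<close>, and \<open>M e \<noteq> - e\<close> because no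
  piece of a zigzag is a palindrome. Hence \<open>e \<mapsto> - M e\<close> is a fixed-point-free involution of the six
  oriented edges of \<open>F\<close>, and the 15 such involutions are exactly those of (M1)--(M7). The zigzags
  through \<open>F\<close> correspond to the cycles of \<open>P\<close>: in (M1)--(M4) these are two 3-cycles, whereas in
  (M5)--(M7) there are two fixed points, hence at least three cycles.

  For this the faces have to be known to be triangles. By invariance of domain the interior of the
  disc \<open>F\<close> is open in the surface, and since every edge lies in two faces it misses all edges. So
  the boundary circle of \<open>F\<close> is the union of its three edges, and a circle stays connected when a
  point is removed, which forces every end of one of the edges to lie on another one.\<close>

section \<open>Discs in surfaces\<close>

text \<open>A chart is shrunk to the part over a small round ball inside the planar image of
  \<open>U \<inter> V\<close>. Openness of \<open>W\<close> serves invariance of domain,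
  connectedness of \<open>W\<close> serves local connectedness.\<close>

lemma ball_chart:
  fixes S :: "'a::t2_space set"
  assumes S: "closed_surface S" and V: "openin (top_of_set S) V" and x: "x \<in> V"
  obtains B h g and W :: "(real ^ 2) set"
  where "openin (top_of_set S) B" "x \<in> B" "B \<subseteq> V" "open W" "connected W" "homeomorphism B W h g"
proof -
  have "x \<in> S" using V x openin_imp_subset by blast
  then obtain U and W :: "(real ^ 2) set"
    where U: "openin (top_of_set S) U" "x \<in> U" and W: "open W" "U homeomorphic W"
    using S unfolding closed_surface_def by blast
  obtain h g where hg: "homeomorphism U W h g"
    using W(2) unfolding homeomorphic_def by blast
  have "openin (top_of_set U) (U \<inter> V)"
    using V U openin_imp_subset openin_subset_trans
    by (metis inf_le1 openin_Int)
  then have "openin (top_of_set W) (h ` (U \<inter> V))"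
    using homeomorphism_imp_open_map[OF hg] by blast
  then have "open (h ` (U \<inter> V))" using W(1) openin_open_eq by blast
  moreover have "h x \<in> h ` (U \<inter> V)" using U x by blast
  ultimately obtain r where r: "r > 0" "ball (h x) r \<subseteq> h ` (U \<inter> V)"
    using open_contains_ball by blast
  let ?W = "ball (h x) r" and ?B = "g ` ball (h x) r"
  have WW: "?W \<subseteq> W" using r(2) homeomorphism_image1[OF hg] by blast
  have ghU: "g (h y) = y" if "y \<in> U" for y using hg that by (simp add: homeomorphism_def)
  have BU: "?B \<subseteq> U \<inter> V" using r(2) ghU by fastforce
  have "homeomorphism W U g h" using hg homeomorphism_symD by blast
  then have hom: "homeomorphism ?W ?B g h"
    using homeomorphism_of_subsets WW BU by (metis Int_subset_iff homeomorphism_image1 image_mono)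
  have "openin (top_of_set U) ?B"
    using homeomorphism_imp_open_map[OF \<open>homeomorphism W U g h\<close>, of ?W] WW
    by (simp add: openin_open_eq W(1))
  then have "openin (top_of_set S) ?B" using U(1) openin_trans by blast
  moreover have "x \<in> ?B"
    using r(1) ghU[OF U(2)] by (metis centre_in_ball imageI)
  moreover have "?B \<subseteq> V" using BU by blast
  ultimately show ?thesis
    using that[of ?B ?W h g] homeomorphism_symD[OF hom] by simp
qed

text \<open>Surfaces are locally connected: a connected chart inside \<open>V\<close> around a point
  of \<open>C\<close> is absorbed by \<open>C\<close>, because components are maximal connected
  sets.\<close>

lemma openin_component:
  fixes S :: "'a::t2_space set"
  assumes S: "closed_surface S" and V: "openin (top_of_set S) V" and C: "C \<in> components V"
  shows "openin (top_of_set S) C"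
proof (subst openin_subopen, intro ballI)
  fix x assume x: "x \<in> C"
  then have "x \<in> V" using C in_components_subset by blast
  then obtain B h g and W :: "(real ^ 2) set"
    where B: "openin (top_of_set S) B" "x \<in> B" "B \<subseteq> V" "connected W" "homeomorphism B W h g"
    using ball_chart[OF S V] by metis
  have "connected B"
    using B(4,5) homeomorphic_connectedness homeomorphic_def by blast
  then have "B \<subseteq> C" using components_maximal[OF C] B x by blast
  then show "\<exists>T. openin (top_of_set S) T \<and> x \<in> T \<and> T \<subseteq> C" using B by blast
qed

text \<open>Invariance of domain, carried from the plane to the surface by charts.\<close>

lemma openin_surface_if_homeomorphic_open:
  fixes S :: "'a::t2_space set" and W :: "(real ^ 2) set"
  assumes S: "closed_surface S" and K: "K \<subseteq> S" "K homeomorphic W" and W: "open W"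
  shows "openin (top_of_set S) K"
proof (subst openin_subopen, intro ballI)
  fix x assume x: "x \<in> K"
  obtain k j where kj: "homeomorphism K W k j" using K(2) homeomorphic_def by blast
  obtain B h g and W' :: "(real ^ 2) set"
    where B: "openin (top_of_set S) B" "x \<in> B" "open W'" "homeomorphism B W' h g"
    using ball_chart[OF S openin_subtopology_self] K x by (metis subsetD)
  have "openin (top_of_set K) (K \<inter> B)"
    using openin_subtopology_Int_subset[of S B K] B(1) K(1) openin_imp_subset[OF B(1)]
    by (simp add: Int_absorb1)
  then have "openin (top_of_set W) (k ` (K \<inter> B))"
    using homeomorphism_imp_open_map[OF kj] by blast
  then have o: "open (k ` (K \<inter> B))" using W openin_open_eq by blast
  have jk: "j (k y) = y" if "y \<in> K" for y using kj that by (simp add: homeomorphism_def)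
  have gh: "g (h y) = y" if "y \<in> B" for y using B(4) that by (simp add: homeomorphism_def)
  have im: "k ` (K \<inter> B) \<subseteq> W" using kj by (auto simp: homeomorphism_def)
  have jim: "j ` (k ` (K \<inter> B)) = K \<inter> B" using jk by force
  \<comment> \<open>\<open>h \<circ> j\<close> is the transition map from the parametrization of
    \<open>K\<close> to the chart on \<open>B\<close>, an injective continuous map on a planar open
    set.\<close>
  have "continuous_on (k ` (K \<inter> B)) (h \<circ> j)"
    using kj B(4) im jim
    by (intro continuous_on_compose) (auto simp: homeomorphism_def intro: continuous_on_subset)
  moreover have "inj_on (h \<circ> j) (k ` (K \<inter> B))"
    using jk gh by (auto simp: inj_on_def) metis
  ultimately have "open ((h \<circ> j) ` k ` (K \<inter> B))" using invariance_of_domain o by blast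
  then have "open (h ` (K \<inter> B))" by (metis jim image_comp)
  moreover have "h ` (K \<inter> B) \<subseteq> W'" using B(4) by (auto simp: homeomorphism_def)
  ultimately have "openin (top_of_set B) (g ` h ` (K \<inter> B))"
    using homeomorphism_imp_open_map[OF homeomorphism_symD[OF B(4)]] B(3) by (simp add: openin_open_eq)
  moreover have "g ` h ` (K \<inter> B) = K \<inter> B" using gh by force
  ultimately have "openin (top_of_set S) (K \<inter> B)" using B(1) openin_trans by metis
  then show "\<exists>T. openin (top_of_set S) T \<and> x \<in> T \<and> T \<subseteq> K" using x B by blast
qed

text \<open>Reading a chart around a point of \<open>C\<close> through \<open>f\<close> gives an
  open planar set inside the closed disc, hence inside its interior. So no point of \<open>C\<close>
  lands on the boundary circle.\<close>

lemma surface_open_subset_of_disc: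
  fixes S :: "'a::t2_space set" and f :: "'a \<Rightarrow> real ^ 2"
  assumes S: "closed_surface S" and C: "openin (top_of_set S) C" "C \<subseteq> F"
    and f: "homeomorphism F (cball 0 1) f f'"
  shows "f ` C \<subseteq> ball 0 1"
proof
  fix y assume "y \<in> f ` C"
  then obtain x where x: "x \<in> C" "y = f x" by blast
  obtain B h g and W :: "(real ^ 2) set"
    where B: "x \<in> B" "B \<subseteq> C" "open W" "homeomorphism B W h g"
    using ball_chart[OF S C(1) x(1)] by metis
  have gW: "g ` W = B" and hg: "\<And>w. w \<in> W \<Longrightarrow> h (g w) = w" using B(4) by (auto simp: homeomorphism_def)
  have ff: "f' (f z) = z" if "z \<in> F" for z using f that by (simp add: homeomorphism_def)
  have "continuous_on W (f \<circ> g)"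
    using B f C(2) by (intro continuous_on_compose) (auto simp: homeomorphism_def intro: continuous_on_subset)
  moreover have "inj_on (f \<circ> g) W"
    using ff hg gW B C(2) unfolding inj_on_def comp_def by (metis imageI subsetD)
  ultimately have "open ((f \<circ> g) ` W)" using invariance_of_domain B(3) by blast
  then have "open (f ` B)" by (metis gW image_comp)
  moreover have "f ` B \<subseteq> cball 0 1" using f B C(2) by (auto simp: homeomorphism_def)
  ultimately have "f ` B \<subseteq> interior (cball 0 1)" using interior_maximal by blast
  then show "y \<in> ball 0 1" using x B by auto
qed

section \<open>The boundary circle\<close>

lemma connected_circle_minus_point:
  fixes p :: "real ^ 2"
  assumes "p \<in> sphere 0 1"
  shows "connected (sphere 0 1 - {p})"
proof -
  have "(axis 1 1 :: real ^ 2) \<noteq> 0" by (simp add: axis_eq_0_iff)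
  \<comment> \<open>Stereographic projection; a hyperplane of the plane is a line, hence
    convex.\<close>
  then have "(sphere 0 1 - {p}) homeomorphic {x :: real ^ 2. axis 1 1 \<bullet> x = 0}"
    using assms by (intro homeomorphic_punctured_sphere_hyperplane) auto
  then show ?thesis using homeomorphic_connectedness convex_hyperplane convex_connected by metis
qed

text \<open>A finite connected set has at most one point, but the circle contains antipodal
  points.\<close>

lemma infinite_circle: "infinite (sphere (0 :: real ^ 2) 1)"
proof
  assume fin: "finite (sphere (0 :: real ^ 2) 1)"
  have "connected (sphere (0 :: real ^ 2) 1)" by (simp add: connected_sphere)
  then have "\<exists>p. sphere (0 :: real ^ 2) 1 \<subseteq> {p}"
    using connected_finite_iff_sing[of "sphere (0 :: real ^ 2) 1"] fin by auto
  moreover have "axis 1 1 \<in> sphere (0 :: real ^ 2) 1" "- axis 1 1 \<in> sphere (0 :: real ^ 2) 1"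
    by simp_all
  ultimately have "(axis 1 1 :: real ^ 2) = - axis 1 1" by (metis singletonD subsetD)
  then have "(axis 1 1 :: real ^ 2) $ 1 = (- axis 1 1 :: real ^ 2) $ 1" by (rule arg_cong)
  then show False by (simp add: axis_def)
qed

section \<open>Strips of triangles\<close>

definition ordered_pairs :: "'a set \<Rightarrow> ('a \<times> 'a) set" where
  "ordered_pairs t = {(x, y). x \<in> t \<and> y \<in> t \<and> x \<noteq> y}"

lemma swap_ordered_pairs [simp]: "prod.swap e \<in> ordered_pairs t \<longleftrightarrow> e \<in> ordered_pairs t"
  by (cases e) (auto simp: ordered_pairs_def)

text \<open>The combinatorial shadow of a triangulation: faces become vertex triples, and each edge
  of a triple lies in exactly one further triple. The whole monodromy argument takes place here;
  topology enters only when the faces of \<Gamma> are shown to be an instance.\<close>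

locale closed_pseudosurface =
  fixes T :: "'a set set"
  assumes fin: "finite (\<Union>T)"
    and card3: "t \<in> T \<Longrightarrow> card t = 3"
    and opposite: "t \<in> T \<Longrightarrow> x \<in> t \<Longrightarrow> y \<in> t \<Longrightarrow> x \<noteq> y \<Longrightarrow> \<exists>!t'. t' \<in> T \<and> t' \<noteq> t \<and> x \<in> t' \<and> y \<in> t'"
begin

text \<open>A strip is the vertex sequence of a zigzag; \<open>v i \<noteq> v (i + 3)\<close> says that consecutive faces
  differ.\<close>

definition strip :: "(nat \<Rightarrow> 'a) \<Rightarrow> bool" where
  "strip v \<longleftrightarrow> (\<forall>i. {v i, v (Suc i), v (Suc (Suc i))} \<in> T \<and> v i \<noteq> v (Suc (Suc (Suc i))))"

lemma triangle_distinct: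
  assumes "{x, y, z} \<in> T"
  shows "x \<noteq> y" "y \<noteq> z" "x \<noteq> z"
  using card3[OF assms] by (auto simp: card_insert_if split: if_splits)

lemma triangle_third:
  assumes "t \<in> T" "x \<in> t" "y \<in> t" "x \<noteq> y"
  obtains z where "t = {x, y, z}"
proof -
  have f: "finite t" using card3[OF assms(1)] card.infinite by fastforce
  then have "card (t - {x, y}) = 1" using card3[OF assms(1)] assms by (simp add: card_Diff_subset)
  then obtain z where "t - {x, y} = {z}" using card_1_singletonE by blast
  then have "t = {x, y, z}" using assms by blast
  then show ?thesis using that by blast
qed

lemma triangle_eq:
  assumes "t \<in> T" "x \<in> t" "y \<in> t" "z \<in> t" "x \<noteq> y" "y \<noteq> z" "x \<noteq> z"
  shows "t = {x, y, z}"
proof -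
  obtain w where "t = {x, y, w}" using triangle_third assms by metis
  then show ?thesis using assms by blast
qed

lemma strip_distinct:
  assumes "strip v"
  shows "v i \<noteq> v (Suc i)" "v i \<noteq> v (Suc (Suc i))" "v i \<noteq> v (Suc (Suc (Suc i)))"
  using assms triangle_distinct unfolding strip_def by blast+

lemma next_vertex_ex:
  assumes "{x, y, z} \<in> T"
  shows "\<exists>w. {y, z, w} \<in> T \<and> w \<noteq> x"
proof -
  obtain t where t: "t \<in> T" "t \<noteq> {x, y, z}" "y \<in> t" "z \<in> t"
    using opposite[OF assms, of y z] triangle_distinct[OF assms] by auto
  then obtain w where "t = {y, z, w}" using triangle_third triangle_distinct(2)[OF assms] by metis
  then show ?thesis using t by (metis insert_commute)
qed

lemma next_vertex_unique:
  assumes "{x, y, z} \<in> T" "{y, z, w} \<in> T" "{y, z, w'} \<in> T" "w \<noteq> x" "w' \<noteq> x"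
  shows "w = w'"
proof -
  have d: "w \<notin> {y, z}" "w' \<notin> {y, z}" "x \<notin> {y, z}" "y \<noteq> z"
    using triangle_distinct assms(1-3) by blast+
  then have "{y, z, w} \<noteq> {x, y, z}" "{y, z, w'} \<noteq> {x, y, z}" using assms(4,5) by blast+
  then have "{y, z, w} = {y, z, w'}" using opposite[OF assms(1), of y z] assms d(4) by blast
  then show ?thesis using d by blast
qed

lemma strip_ex:
  assumes "{x, y, z} \<in> T"
  obtains v where "strip v" "v 0 = x" "v 1 = y" "v 2 = z"
proof -
  \<comment> \<open>\<open>w a b c\<close> is the apex of the second triangle over the edge from
    \<open>b\<close> to \<open>c\<close>.\<close>
  define w where "w a b c = (SOME w. {b, c, w} \<in> T \<and> w \<noteq> a)" for a b c
  have w: "{b, c, w a b c} \<in> T \<and> w a b c \<noteq> a" if "{a, b, c} \<in> T" for a b c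
    unfolding w_def using someI_ex[OF next_vertex_ex[OF that]] .
  \<comment> \<open>The state is a window of three consecutive vertices, which is exactly what the
    next vertex depends on; \<open>v\<close> reads off the first entry.\<close>
  define s where "s n = ((\<lambda>(a, b, c). (b, c, w a b c)) ^^ n) (x, y, z)" for n
  define v where "v n = fst (s n)" for n
  have s: "fst (snd (s n)) = v (Suc n) \<and> snd (snd (s n)) = v (Suc (Suc n))
      \<and> v (Suc (Suc (Suc n))) = w (v n) (v (Suc n)) (v (Suc (Suc n)))" for n
    by (simp add: v_def s_def split: prod.split)
  have t: "{v n, v (Suc n), v (Suc (Suc n))} \<in> T" for n
  proof (induction n)
    case 0
    then show ?case using assms by (simp add: v_def s_def)
  next
    case (Suc n)
    then show ?case using w s by simp
  qed
  then have "strip v" unfolding strip_def using w s by metis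
  moreover have "v 0 = x" "v 1 = y" "v 2 = z" by (simp_all add: v_def s_def numeral_2_eq_2)
  ultimately show ?thesis using that by blast
qed

section \<open>Strips are determined forwards and backwards\<close>

lemma strip_next:
  assumes "strip v" "{v (Suc i), v (Suc (Suc i)), w} \<in> T" "w \<noteq> v i"
  shows "v (Suc (Suc (Suc i))) = w"
  using assms next_vertex_unique[of "v i" "v (Suc i)" "v (Suc (Suc i))"]
  unfolding strip_def by metis

text \<open>The conditions on a strip are symmetric under reading it backwards, so uniqueness of the
  next vertex, applied to the reversed window, fixes the previous vertex as well.\<close>

lemma strip_prev:
  assumes "strip v" "{w, v (Suc i), v (Suc (Suc i))} \<in> T" "w \<noteq> v (Suc (Suc (Suc i)))"
  shows "v i = w"
  using assms next_vertex_unique[of "v (Suc (Suc (Suc i)))" "v (Suc (Suc i))" "v (Suc i)" w "v i"]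
  unfolding strip_def by (metis insert_commute)

lemma strip_shift: "strip v \<Longrightarrow> strip (\<lambda>i. v (i + k))"
  unfolding strip_def by simp

lemma strip_unique:
  assumes u: "strip u" and v: "strip v"
    and eq: "u 0 = v 0" "u 1 = v 1" "u 2 = v 2"
  shows "u = v"
proof -
  have "u i = v i \<and> u (Suc i) = v (Suc i) \<and> u (Suc (Suc i)) = v (Suc (Suc i))" for i
  proof (induction i)
    case 0
    then show ?case using eq by (simp add: numeral_2_eq_2)
  next
    case (Suc i)
    then have "v (Suc (Suc (Suc i))) = u (Suc (Suc (Suc i)))"
      using strip_next[OF v, of i "u (Suc (Suc (Suc i)))"] u unfolding strip_def by metis
    then show ?case using Suc by simp
  qed
  then show ?thesis by blast
qed

text \<open>A strip that starts with three vertices of \<open>v\<close> in reverse order retraces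
  \<open>v\<close>, since the reversed piece obeys the same local rule. This is the reverse zigzag
  on a finite piece; it stops at index 0 of \<open>v\<close>, hence the bound on
  \<open>i\<close>.\<close>

lemma strip_reverse:
  assumes u: "strip u" and v: "strip v"
    and eq: "u 0 = v (k + 2)" "u 1 = v (k + 1)" "u 2 = v k"
    and i: "i \<le> k + 2"
  shows "u i = v (k + 2 - i)"
proof -
  have "u i = v (k + 2 - i) \<and> u (Suc i) = v (k + 1 - i) \<and> u (Suc (Suc i)) = v (k - i)"
    if "i \<le> k" for i
    using that
  proof (induction i)
    case 0
    then show ?case using eq by (simp add: numeral_2_eq_2)
  next
    case (Suc i)
    \<comment> \<open>Rewrites the truncated differences as successors of \<open>j\<close>, the form
      in which \<open>strip_next\<close> speaks of indices.\<close>
    define j where "j = k - Suc i"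
    have j: "k - i = Suc j" "k + 1 - i = Suc (Suc j)" "k + 2 - i = Suc (Suc (Suc j))"
      using Suc.prems by (auto simp: j_def)
    have IH: "u i = v (Suc (Suc (Suc j)))" "u (Suc i) = v (Suc (Suc j))" "u (Suc (Suc i)) = v (Suc j)"
      using Suc j by auto
    have "{v (Suc (Suc j)), v (Suc j), v j} = {v j, v (Suc j), v (Suc (Suc j))}" by blast
    then have "u (Suc (Suc (Suc i))) = v j"
      using strip_next[OF u, of i "v j"] IH v unfolding strip_def by metis
    then show ?case using IH j Suc.prems by (simp add: j_def)
  qed
  \<comment> \<open>The indices \<open>k + 1\<close> and \<open>k + 2\<close> are covered by the
    last two entries of the window at \<open>k\<close>.\<close>
  from this[of k] this[of "i"] show ?thesis
    using i by (cases "i \<le> k") (auto simp: le_Suc_eq)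
qed

text \<open>There are finitely many windows of three vertices, so one repeats. As strips are also
  determined backwards, the repetition can be moved to index 0, which gives pure
  periodicity.\<close>

lemma strip_periodic:
  assumes v: "strip v"
  obtains n where "n > 0" "\<And>i. v (i + n) = v i"
proof -
  let ?s = "\<lambda>i. (v i, v (Suc i), v (Suc (Suc i)))"
  have "v i \<in> \<Union>T" for i using v unfolding strip_def by blast
  then have "range ?s \<subseteq> \<Union>T \<times> \<Union>T \<times> \<Union>T"
    by (intro image_subsetI SigmaI)
  then have "finite (range ?s)"
    by (rule finite_subset) (intro finite_SigmaI fin)
  then have "\<not> inj ?s" using finite_imageD infinite_UNIV_nat by blast
  then obtain i j where "i < j" "?s i = ?s j" unfolding inj_def by (metis nat_neq_iff)
  then obtain n where n: "n > 0" "?s i = ?s (i + n)" by (metis less_imp_add_positive)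
  \<comment> \<open>Downward induction from \<open>i\<close> to 0, each step recovering one earlier
    vertex by \<open>strip_prev\<close>.\<close>
  have "?s 0 = ?s (0 + n)"
    using le0[of i]
  proof (induction rule: inc_induct)
    case base
    then show ?case using n(2) .
  next
    case (step m)
    then have eq: "v (Suc m) = v (Suc (m + n))" "v (Suc (Suc m)) = v (Suc (Suc (m + n)))"
      "v (Suc (Suc (Suc m))) = v (Suc (Suc (Suc (m + n))))"
      by simp_all
    have "{v (m + n), v (Suc m), v (Suc (Suc m))} \<in> T"
      unfolding eq using v unfolding strip_def by blast
    moreover have "v (m + n) \<noteq> v (Suc (Suc (Suc m)))"
      unfolding eq using strip_distinct(3)[OF v] .
    ultimately have "v m = v (m + n)" using strip_prev[OF v] by blast
    then show ?case using eq by simp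
  qed
  then have "(\<lambda>i. v (i + n)) = v"
    using strip_unique[OF strip_shift[OF v] v] by (simp add: numeral_2_eq_2)
  then show ?thesis using that n(1) by metis
qed

text \<open>The centre of a palindrome yields equal vertices at distance two (\<open>k\<close> even)
  or one (\<open>k\<close> odd), but any three consecutive vertices form a triangle.\<close>

lemma strip_not_palindromic:
  assumes v: "strip v" and pal: "\<And>i. i \<le> k + 2 \<Longrightarrow> v i = v (k + 2 - i)"
  shows False
proof (cases "even k")
  case True
  then obtain j where "k = 2 * j" by blast
  then have "v j = v (Suc (Suc j))" using pal[of j] by (simp add: mult_2)
  then show ?thesis using strip_distinct(2)[OF v] by blast
next
  case False
  then obtain j where "k = 2 * j + 1" by (rule oddE)
  then have "v (Suc j) = v (Suc (Suc j))" using pal[of "Suc j"] by (simp add: mult_2)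
  then show ?thesis using strip_distinct(1)[OF v] by blast
qed

end

section \<open>The first return to a triangle\<close>

definition vertex_walk_edges :: "(nat \<Rightarrow> 'a) \<Rightarrow> nat \<Rightarrow> 'a \<times> 'a" where
  "vertex_walk_edges v i = (v i, v (Suc i))"

definition triangle_rotation :: "'a set \<Rightarrow> 'a \<times> 'a \<Rightarrow> 'a \<times> 'a" where
  "triangle_rotation t = (\<lambda>(x, y).
     if (x, y) \<in> ordered_pairs t then (y, THE z. z \<in> t \<and> z \<noteq> x \<and> z \<noteq> y) else (x, y))"

lemma cyclic_seq_shift:
  assumes "n > 0" "\<And>i. Z (i + n) = Z i"
  shows "cyclic_seq (\<lambda>i. Z (i + k)) = cyclic_seq Z"
proof
  show "cyclic_seq (\<lambda>i. Z (i + k)) \<subseteq> cyclic_seq Z"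
    unfolding cyclic_seq_def by (auto simp: add.assoc)
  show "cyclic_seq Z \<subseteq> cyclic_seq (\<lambda>i. Z (i + k))"
  proof
    fix Y assume "Y \<in> cyclic_seq Z"
    then obtain j where Y: "Y = (\<lambda>i. Z (i + j))" unfolding cyclic_seq_def by blast
    have per: "Z (i + n * m) = Z i" for i m
      by (induction m) (simp_all add: assms(2) add.assoc[symmetric] add.commute[of n])
    have "k \<le> n * k" using assms(1) by simp
    \<comment> \<open>The extra shift by \<open>n * k - k\<close> completes \<open>k\<close> to
      \<open>n * k\<close>, a whole number of periods, so a forward shift is undone by another
      forward shift.\<close>
    have "Y = (\<lambda>i. Z (i + (j + (n * k - k)) + k))"
    proof
      fix i
      have "i + (j + (n * k - k)) + k = i + j + n * k" using \<open>k \<le> n * k\<close> by linarith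
      then show "Y i = Z (i + (j + (n * k - k)) + k)" using per Y by metis
    qed
    then show "Y \<in> cyclic_seq (\<lambda>i. Z (i + k))" unfolding cyclic_seq_def by blast
  qed
qed

locale marked_pseudosurface = closed_pseudosurface +
  fixes t
  assumes t: "t \<in> T"
begin

abbreviation \<Omega> where "\<Omega> \<equiv> ordered_pairs t"
abbreviation D where "D \<equiv> triangle_rotation t"

text \<open>The zigzag that starts with \<open>e, D e\<close>: requiring the third vertex to lie in
  \<open>t\<close> makes \<open>t\<close> its first triangle.\<close>

definition strip_from :: "'a \<times> 'a \<Rightarrow> nat \<Rightarrow> 'a" where
  "strip_from e = (THE v. strip v \<and> v 0 = fst e \<and> v 1 = snd e \<and> v 2 \<in> t)"

text \<open>For \<open>e\<close> in \<Omega>, the indices 0 and 1 are occupied by \<open>e\<close>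
  and \<open>D e\<close>, which lie in \<Omega> themselves; the search starts after them, as in
  \<open>z_monodromy\<close>.\<close>

definition return_time :: "'a \<times> 'a \<Rightarrow> nat" where
  "return_time e = (LEAST k. k > 1 \<and> vertex_walk_edges (strip_from e) k \<in> \<Omega>)"

text \<open>The map \<open>P\<close> of the overview.\<close>

definition first_return :: "'a \<times> 'a \<Rightarrow> 'a \<times> 'a" where
  "first_return e = vertex_walk_edges (strip_from e) (return_time e)"

definition strip_class :: "'a \<times> 'a \<Rightarrow> (nat \<Rightarrow> 'a \<times> 'a) set" where
  "strip_class e = cyclic_seq (vertex_walk_edges (strip_from e))"

lemma strip_vertices_t:
  assumes v: "strip v" and i: "v i \<in> t" "v (Suc i) \<in> t" "v (Suc (Suc i)) \<in> t"
  shows "t = {v i, v (Suc i), v (Suc (Suc i))}"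
  using triangle_eq[OF t i] strip_distinct[OF v] by blast

text \<open>The next vertex differs from the preceding three, which exhaust
  \<open>t\<close>.\<close>

lemma strip_leaves:
  assumes v: "strip v" and i: "v i \<in> t" "v (Suc i) \<in> t" "v (Suc (Suc i)) \<in> t"
  shows "v (Suc (Suc (Suc i))) \<notin> t"
  using strip_vertices_t[OF assms] strip_distinct[OF v] by (metis empty_iff insert_iff)

text \<open>The edge from \<open>v (Suc i)\<close> to \<open>v (Suc (Suc i))\<close> lies in only
  two triangles, those before and after it in the strip. As \<open>v i\<close> is outside
  \<open>t\<close>, the later one must be \<open>t\<close>.\<close>

lemma strip_enters:
  assumes v: "strip v" and i: "v i \<notin> t" "v (Suc i) \<in> t" "v (Suc (Suc i)) \<in> t"
  shows "v (Suc (Suc (Suc i))) \<in> t"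
proof -
  have T: "{v i, v (Suc i), v (Suc (Suc i))} \<in> T"
    "{v (Suc i), v (Suc (Suc i)), v (Suc (Suc (Suc i)))} \<in> T"
    using v unfolding strip_def by blast+
  moreover have "v i \<notin> {v (Suc i), v (Suc (Suc i)), v (Suc (Suc (Suc i)))}"
    using strip_distinct[OF v, of i] by blast
  ultimately have "t = {v (Suc i), v (Suc (Suc i)), v (Suc (Suc (Suc i)))}"
    using opposite[OF T(1), of "v (Suc i)" "v (Suc (Suc i))"] t i strip_distinct(1)[OF v, of "Suc i"]
    by (metis insertCI)
  then show ?thesis by blast
qed

lemma strip_from_eqI:
  assumes e: "e \<in> \<Omega>" and v: "strip v" "v 0 = fst e" "v 1 = snd e" "v 2 \<in> t"
  shows "strip_from e = v"
  unfolding strip_from_def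
proof (rule the_equality)
  fix u assume u: "strip u \<and> u 0 = fst e \<and> u 1 = snd e \<and> u 2 \<in> t"
  have "v 0 \<in> t" "v 1 \<in> t" using e v(2,3) by (auto simp: ordered_pairs_def)
  then have "t = {v 0, v 1, v 2}" "t = {u 0, u 1, u 2}"
    using strip_vertices_t[of v 0] strip_vertices_t[of u 0] u v by (simp_all add: numeral_2_eq_2)
  moreover have "u 2 \<notin> {u 0, u 1}" using strip_distinct[of u] u by (auto simp: numeral_2_eq_2) metis+
  ultimately have "u 2 = v 2" using u v(2,3) by auto
  then show "u = v" using strip_unique u v by metis
qed (use v in blast)

lemma strip_from:
  assumes e: "e \<in> \<Omega>"
  shows "strip (strip_from e)" "strip_from e 0 = fst e" "strip_from e (Suc 0) = snd e"
    "strip_from e (Suc (Suc 0)) \<in> t"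
proof -
  have xy: "fst e \<in> t" "snd e \<in> t" "fst e \<noteq> snd e" using e by (auto simp: ordered_pairs_def)
  then obtain z where z: "t = {fst e, snd e, z}" using triangle_third t by metis
  then have "{fst e, snd e, z} \<in> T" using t by simp
  then obtain v where v: "strip v" "v 0 = fst e" "v 1 = snd e" "v 2 = z" by (rule strip_ex)
  then have "strip_from e = v" using strip_from_eqI[OF e] z by blast
  then show "strip (strip_from e)" "strip_from e 0 = fst e" "strip_from e (Suc 0) = snd e"
    "strip_from e (Suc (Suc 0)) \<in> t"
    using v z by (simp_all add: numeral_2_eq_2)
qed

lemma rotation_eq:
  assumes "t = {x, y, z}"
  shows "D (x, y) = (y, z)"
proof -
  have "x \<noteq> y" "y \<noteq> z" "x \<noteq> z" using triangle_distinct t assms by blast+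
  moreover from this have "(THE w. w \<in> t \<and> w \<noteq> x \<and> w \<noteq> y) = z"
    using assms by (intro the_equality) auto
  ultimately show ?thesis using assms by (simp add: triangle_rotation_def ordered_pairs_def)
qed

lemma rotation_outside: "e \<notin> \<Omega> \<Longrightarrow> D e = e"
  by (cases e) (simp add: triangle_rotation_def)

text \<open>The last equation is the reversal rule: the consecutive pair \<open>e, D e\<close> read
  backwards is \<open>- D e, - e\<close>, again a pair of this form.\<close>

lemma rotation:
  assumes e: "e \<in> \<Omega>"
  shows "D e \<in> \<Omega>" "D (D (D e)) = e" "D (prod.swap (D e)) = prod.swap e"
proof -
  obtain x y where xy: "e = (x, y)" "x \<in> t" "y \<in> t" "x \<noteq> y"
    using e by (auto simp: ordered_pairs_def)
  then obtain z where z: "t = {x, y, z}" using triangle_third t by metis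
  then have d: "x \<noteq> y" "y \<noteq> z" "x \<noteq> z" using triangle_distinct t by blast+
  have eqs: "t = {y, z, x}" "t = {z, x, y}" "t = {z, y, x}" using z by blast+
  show "D e \<in> \<Omega>" using xy rotation_eq[OF z] d z by (auto simp: ordered_pairs_def)
  show "D (D (D e)) = e" using xy rotation_eq[OF z] eqs[THEN rotation_eq] by simp
  show "D (prod.swap (D e)) = prod.swap e" using xy rotation_eq[OF z] eqs[THEN rotation_eq] by simp
qed

lemma strip_rotation:
  assumes "strip v" "v i \<in> t" "v (Suc i) \<in> t" "v (Suc (Suc i)) \<in> t"
  shows "D (v i, v (Suc i)) = (v (Suc i), v (Suc (Suc i)))"
  using rotation_eq strip_vertices_t[OF assms] by blast

lemma rotation_strip_from:
  assumes e: "e \<in> \<Omega>"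
  shows "D e = (strip_from e (Suc 0), strip_from e (Suc (Suc 0)))"
  using strip_rotation[of "strip_from e" 0] strip_from[OF e] e by (simp add: ordered_pairs_def split_beta)

text \<open>Periodicity guarantees a return. The third claim says that it is an entry into
  \<open>t\<close> and not an exit, so that \<open>first_return e\<close> can serve as a new
  starting edge.\<close>

lemma return_time:
  assumes e: "e \<in> \<Omega>"
  shows "return_time e > 1" "first_return e \<in> \<Omega>"
    "strip_from e (Suc (Suc (return_time e))) \<in> t"
    "k > 1 \<Longrightarrow> vertex_walk_edges (strip_from e) k \<in> \<Omega> \<Longrightarrow> return_time e \<le> k"
proof -
  let ?v = "strip_from e" and ?P = "\<lambda>k. k > 1 \<and> vertex_walk_edges (strip_from e) k \<in> \<Omega>"
  obtain n where n: "n > 0" "\<And>i. ?v (i + n) = ?v i" using strip_periodic strip_from(1)[OF e] by metis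
  \<comment> \<open>Two periods are taken so that the index exceeds 1 even if
    \<open>n = 1\<close>.\<close>
  have "?v (n + n) = ?v 0" "?v (Suc (n + n)) = ?v (Suc 0)"
    using n(2)[of n] n(2)[of 0] n(2)[of "Suc n"] n(2)[of "Suc 0"] by simp_all
  then have "?P (n + n)" using n(1) e strip_from(2,3)[OF e] by (simp add: vertex_walk_edges_def)
  then have P: "?P (return_time e)" unfolding return_time_def by (rule LeastI)
  show least: "return_time e \<le> k" if "k > 1" "vertex_walk_edges (strip_from e) k \<in> \<Omega>" for k
    unfolding return_time_def using that by (intro Least_le) simp
  show "return_time e > 1" using P by blast
  show "first_return e \<in> \<Omega>" using P unfolding first_return_def by blast
  obtain i where i: "return_time e = Suc i" "i > 0" using P by (metis Suc_lessE One_nat_def)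
  have it: "?v (Suc i) \<in> t" "?v (Suc (Suc i)) \<in> t"
    using P i by (auto simp: vertex_walk_edges_def ordered_pairs_def)
  \<comment> \<open>Otherwise the edge at \<open>i\<close> would be an earlier return unless
    \<open>i = 1\<close>, and then \<open>t\<close> would be used twice in a row, against
    \<open>strip_leaves\<close>.\<close>
  have "?v i \<notin> t"
  proof
    assume "?v i \<in> t"
    then have "vertex_walk_edges ?v i \<in> \<Omega>"
      using it strip_distinct(1)[OF strip_from(1)[OF e]]
      by (auto simp: vertex_walk_edges_def ordered_pairs_def)
    then have "i = 1" using least[of i] i by force
    then have "?v (Suc (Suc (Suc 0))) \<in> t" using it by simp
    moreover have "?v 0 \<in> t" "?v (Suc 0) \<in> t" using strip_from[OF e] e by (auto simp: ordered_pairs_def)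
    ultimately show False using strip_leaves[of ?v 0] strip_from[OF e] by blast
  qed
  then show "?v (Suc (Suc (return_time e))) \<in> t"
    using strip_enters[OF strip_from(1)[OF e]] it i by simp
qed

section \<open>The first return map and reversal\<close>

lemma first_return_components:
  "fst (first_return e) = strip_from e (return_time e)"
  "snd (first_return e) = strip_from e (Suc (return_time e))"
  by (simp_all add: first_return_def vertex_walk_edges_def)

lemma strip_from_first_return:
  assumes e: "e \<in> \<Omega>"
  shows "strip_from (first_return e) = (\<lambda>i. strip_from e (i + return_time e))"
  using return_time[OF e] strip_shift[OF strip_from(1)[OF e]]
  by (intro strip_from_eqI) (simp_all add: first_return_components numeral_2_eq_2)

lemma rotation_first_return:
  assumes e: "e \<in> \<Omega>"
  shows "D (first_return e)
    = (strip_from e (Suc (return_time e)), strip_from e (Suc (Suc (return_time e))))"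
  using rotation_strip_from[OF return_time(2)[OF e]] by (simp add: strip_from_first_return[OF e])

text \<open>The visit at the return time is the pair \<open>P e, D (P e)\<close>. Reversed, it
  starts the strip from \<open>- D (P e)\<close>, which therefore runs back along the piece just
  traversed.\<close>

lemma strip_from_reverse:
  assumes e: "e \<in> \<Omega>" and i: "i \<le> return_time e + 2"
  shows "strip_from (prod.swap (D (first_return e))) i = strip_from e (return_time e + 2 - i)"
proof -
  let ?v = "strip_from e" and ?k = "return_time e" and ?f = "prod.swap (D (first_return e))"
  have f: "?f \<in> \<Omega>" using rotation return_time(2) e by simp
  have "D ?f = prod.swap (first_return e)" using rotation(3) return_time(2) e by simp
  then have "strip_from ?f (Suc (Suc 0)) = ?v ?k"
    using rotation_strip_from[OF f] by (metis first_return_components(1) snd_conv snd_swap)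
  then show ?thesis
    using strip_reverse[OF strip_from(1)[OF f] strip_from(1)[OF e] _ _ _ i] strip_from(2,3)[OF f]
      rotation_first_return[OF e]
    by (simp add: numeral_2_eq_2)
qed

text \<open>The reversed piece starts in \<open>t\<close> and ends with \<open>- D e, - e\<close>.
  It has no earlier return, because such a return would reverse to one of the original
  piece.\<close>

lemma first_return_reverse:
  assumes e: "e \<in> \<Omega>"
  shows "first_return (prod.swap (D (first_return e))) = prod.swap (D e)"
proof -
  let ?v = "strip_from e" and ?k = "return_time e" and ?f = "prod.swap (D (first_return e))"
  have f: "?f \<in> \<Omega>" using rotation return_time(2) e by simp
  note rev = strip_from_reverse[OF e]
  have k1: "?k > 1" using return_time(1)[OF e] .
  have k: "vertex_walk_edges (strip_from ?f) ?k = prod.swap (D e)"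
    using rev[of ?k] rev[of "Suc ?k"] rotation_strip_from[OF e]
    by (simp add: vertex_walk_edges_def numeral_2_eq_2)
  have "return_time ?f = ?k"
    unfolding return_time_def[of ?f]
  proof (rule Least_equality)
    show "?k > 1 \<and> vertex_walk_edges (strip_from ?f) ?k \<in> \<Omega>"
      using k k1 rotation(1)[OF e] by simp
    fix j assume j: "j > 1 \<and> vertex_walk_edges (strip_from ?f) j \<in> \<Omega>"
    show "?k \<le> j"
    proof (rule ccontr)
      assume "\<not> ?k \<le> j"
      \<comment> \<open>Edge \<open>j\<close> of the reversed piece is edge
        \<open>?k + 1 - j\<close> of the original; the range strictly between 1 and
        \<open>?k\<close> is mapped to itself.\<close>
      then have "vertex_walk_edges (strip_from ?f) j = prod.swap (vertex_walk_edges ?v (Suc ?k - j))"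
        using rev[of j] rev[of "Suc j"] by (simp add: vertex_walk_edges_def Suc_diff_le)
      then have "vertex_walk_edges ?v (Suc ?k - j) \<in> \<Omega>" using j by simp
      then have "?k \<le> Suc ?k - j" using return_time(4)[OF e] \<open>\<not> ?k \<le> j\<close> by simp
      then show False using j k1 by linarith
    qed
  qed
  then show ?thesis using k unfolding first_return_def by metis
qed

text \<open>If \<open>P e = - D e\<close>, then \<open>- D (P e) = e\<close>, so the piece would
  equal its own reverse, a palindrome.\<close>

lemma first_return_neq:
  assumes e: "e \<in> \<Omega>"
  shows "first_return e \<noteq> prod.swap (D e)"
proof
  assume "first_return e = prod.swap (D e)"
  then have "prod.swap (D (first_return e)) = e" using rotation(3)[OF e] by simp
  then show False
    using strip_from_reverse[OF e] strip_not_palindromic[OF strip_from(1)[OF e]] by metis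
qed

section \<open>Cyclic classes of strips and orbits of the first return\<close>

lemma strip_class_first_return:
  assumes e: "e \<in> \<Omega>"
  shows "strip_class (first_return e) = strip_class e"
proof -
  obtain n where n: "n > 0" "\<And>i. strip_from e (i + n) = strip_from e i"
    using strip_periodic strip_from(1)[OF e] by metis
  have "vertex_walk_edges (strip_from e) (i + n) = vertex_walk_edges (strip_from e) i" for i
    using n(2)[of i] n(2)[of "Suc i"] by (simp add: vertex_walk_edges_def)
  then have "cyclic_seq (\<lambda>i. vertex_walk_edges (strip_from e) (i + return_time e)) = strip_class e"
    unfolding strip_class_def using cyclic_seq_shift n(1) by metis
  moreover have "vertex_walk_edges (strip_from (first_return e))
      = (\<lambda>i. vertex_walk_edges (strip_from e) (i + return_time e))"
    by (simp add: strip_from_first_return[OF e] vertex_walk_edges_def fun_eq_iff)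
  ultimately show ?thesis unfolding strip_class_def by simp
qed

text \<open>Every entry into \<open>t\<close> is reached by iterating \<open>first_return\<close>:
  index 0 is the start, index 1 is excluded by \<open>strip_leaves\<close>, and any later entry is
  an earlier one of the strip restarted at the first return.\<close>

lemma invariant_set_visits:
  assumes S: "S \<subseteq> \<Omega>" "\<And>e. e \<in> S \<Longrightarrow> first_return e \<in> S"
    and e: "e \<in> S"
    and k: "strip_from e k \<in> t" "strip_from e (Suc k) \<in> t" "strip_from e (Suc (Suc k)) \<in> t"
  shows "vertex_walk_edges (strip_from e) k \<in> S"
  using e k
proof (induction k arbitrary: e rule: less_induct)
  case (less k)
  have e: "e \<in> \<Omega>" using S(1) less.prems(1) by blast
  note v = strip_from[OF e]
  show ?case
  proof (cases "k = 0")
    case True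
    then show ?thesis using less.prems(1) v(2,3) by (simp add: vertex_walk_edges_def)
  next
    case False
    have "k \<noteq> 1"
    proof
      assume "k = 1"
      moreover have "strip_from e 0 \<in> t" "strip_from e (Suc 0) \<in> t"
        using v e by (auto simp: ordered_pairs_def)
      ultimately show False using strip_leaves[OF v(1), of 0] v(4) less.prems(4) by simp
    qed
    then have "k > 1" using False by simp
    moreover have "vertex_walk_edges (strip_from e) k \<in> \<Omega>"
      using less.prems(2,3) strip_distinct(1)[OF v(1)]
      by (auto simp: vertex_walk_edges_def ordered_pairs_def)
    ultimately have r: "return_time e \<le> k" using return_time(4)[OF e] by blast
    have "vertex_walk_edges (strip_from (first_return e)) (k - return_time e) \<in> S"
      using r less.prems return_time(1)[OF e] S(2)
      by (intro less.IH) (simp_all add: strip_from_first_return[OF e] Suc_diff_le[symmetric])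
    then show ?thesis using r by (simp add: vertex_walk_edges_def strip_from_first_return[OF e])
  qed
qed

text \<open>If \<open>e'\<close> has the class of \<open>e\<close>, the strip from \<open>e\<close>
  enters \<open>t\<close> through \<open>e'\<close> at some time. Disjoint orbits thus give
  different zigzags, which bounds their number from below.\<close>

lemma strip_class_separation:
  assumes S: "S \<subseteq> \<Omega>" "\<And>e. e \<in> S \<Longrightarrow> first_return e \<in> S"
    and e: "e \<in> S" and e': "e' \<in> \<Omega>" "strip_class e' = strip_class e"
  shows "e' \<in> S"
proof -
  have "vertex_walk_edges (strip_from e') \<in> strip_class e'"
    unfolding strip_class_def cyclic_seq_def by (auto intro: exI[of _ 0])
  then obtain k where k: "vertex_walk_edges (strip_from e')
      = (\<lambda>i. vertex_walk_edges (strip_from e) (i + k))"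
    using e'(2) unfolding strip_class_def cyclic_seq_def by auto
  have "strip_from e' i = strip_from e (i + k)" for i
    using fun_cong[OF k, of i] by (simp add: vertex_walk_edges_def)
  from this[of 0] this[of "Suc 0"] this[of "Suc (Suc 0)"]
  have "vertex_walk_edges (strip_from e) k \<in> S" "vertex_walk_edges (strip_from e) k = e'"
    using invariant_set_visits[OF S e, of k] strip_from[OF e'(1)] e'(1)
    by (auto simp: ordered_pairs_def vertex_walk_edges_def)
  then show ?thesis by simp
qed

text \<open>Evaluates the definite description of the zigzag in \<open>z_monodromy\<close>, with
  zigzags replaced by strips.\<close>

lemma strip_edges_unique:
  assumes e: "e \<in> \<Omega>"
  shows "(THE Z. (\<exists>v. strip v \<and> Z = vertex_walk_edges v) \<and> Z 0 = e \<and> Z 1 = D e)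
    = vertex_walk_edges (strip_from e)"
proof (rule the_equality)
  show "(\<exists>v. strip v \<and> vertex_walk_edges (strip_from e) = vertex_walk_edges v)
      \<and> vertex_walk_edges (strip_from e) 0 = e \<and> vertex_walk_edges (strip_from e) 1 = D e"
    using strip_from[OF e] rotation_strip_from[OF e] by (auto simp: vertex_walk_edges_def)
next
  fix Z assume Z: "(\<exists>v. strip v \<and> Z = vertex_walk_edges v) \<and> Z 0 = e \<and> Z 1 = D e"
  then obtain v where v: "strip v" "Z = vertex_walk_edges v" by blast
  then have "v 0 = fst e" "v 1 = snd e" "(v 1, v 2) \<in> \<Omega>"
    using Z rotation(1)[OF e] by (auto simp: vertex_walk_edges_def numeral_2_eq_2)
  then have "strip_from e = v" using v strip_from_eqI[OF e v(1)] by (simp add: ordered_pairs_def)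
  then show "Z = vertex_walk_edges (strip_from e)" using v by simp
qed

lemma rotation_the_inverse:
  assumes e: "e \<in> \<Omega>"
  shows "(THE e\<^sub>0. e\<^sub>0 \<in> \<Omega> \<and> D e\<^sub>0 = D e) = e"
  using e rotation(2) by (intro the_equality) metis+

text \<open>The left side is the set \<open>face_zigzags\<close> with zigzags replaced by strips. A
  strip that contains \<open>e, D e\<close> anywhere is, by periodicity, cyclically the strip
  starting there.\<close>

lemma strip_classes_eq:
  "{cyclic_seq Z | Z. (\<exists>v. strip v \<and> Z = vertex_walk_edges v) \<and> (\<exists>i. \<exists>e\<in>\<Omega>. Z i = e \<and> Z (i + 1) = D e)}
    = strip_class ` \<Omega>"
proof (intro equalityI subsetI)
  fix X assume "X \<in> {cyclic_seq Z | Z. (\<exists>v. strip v \<and> Z = vertex_walk_edges v)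
      \<and> (\<exists>i. \<exists>e\<in>\<Omega>. Z i = e \<and> Z (i + 1) = D e)}"
  then obtain v i e where v: "strip v" "X = cyclic_seq (vertex_walk_edges v)" and e: "e \<in> \<Omega>"
    "vertex_walk_edges v i = e" "vertex_walk_edges v (Suc i) = D e"
    unfolding Suc_eq_plus1 by blast
  have "(v (Suc i), v (Suc (Suc i))) \<in> \<Omega>" using rotation(1)[OF e(1)] e(3) by (simp add: vertex_walk_edges_def)
  then have "strip_from e = (\<lambda>j. v (j + i))"
    using e(2) by (intro strip_from_eqI[OF e(1) strip_shift[OF v(1)]])
      (auto simp: vertex_walk_edges_def ordered_pairs_def)
  then have "strip_class e = cyclic_seq (\<lambda>j. vertex_walk_edges v (j + i))"
    by (simp add: strip_class_def vertex_walk_edges_def[abs_def])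
  moreover obtain n where "n > 0" "\<And>i. v (i + n) = v i" using strip_periodic v(1) by metis
  moreover from this(2)[of "Suc _"] have "vertex_walk_edges v (j + n) = vertex_walk_edges v j" for j
    using \<open>\<And>i. v (i + n) = v i\<close>[of j] by (simp add: vertex_walk_edges_def)
  ultimately have "strip_class e = X" using cyclic_seq_shift v(2) by metis
  then show "X \<in> strip_class ` \<Omega>" using e(1) by blast
next
  fix X assume "X \<in> strip_class ` \<Omega>"
  then obtain e where e: "e \<in> \<Omega>" "X = cyclic_seq (vertex_walk_edges (strip_from e))"
    unfolding strip_class_def by blast
  moreover have "vertex_walk_edges (strip_from e) 0 = e" "vertex_walk_edges (strip_from e) (0 + 1) = D e"
    using strip_from[OF e(1)] rotation_strip_from[OF e(1)] by (auto simp: vertex_walk_edges_def)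
  ultimately show "X \<in> {cyclic_seq Z | Z. (\<exists>v. strip v \<and> Z = vertex_walk_edges v)
      \<and> (\<exists>i. \<exists>e\<in>\<Omega>. Z i = e \<and> Z (i + 1) = D e)}"
    using strip_from(1)[OF e(1)] by blast
qed

end

section \<open>Monodromy\<close>

definition free_involution_on :: "'b set \<Rightarrow> ('b \<Rightarrow> 'b) \<Rightarrow> bool" where
  "free_involution_on A f \<longleftrightarrow> (\<forall>x\<in>A. f x \<in> A \<and> f x \<noteq> x \<and> f (f x) = x)"

lemma free_involution_on_remove:
  assumes "free_involution_on A f" "x \<in> A"
  shows "f x \<in> A - {x}" "f (f x) = x" "free_involution_on (A - {x, f x}) f"
  using assms unfolding free_involution_on_def by (auto, metis)

lemma free_involution_on_4:
  assumes "distinct [p, q, r, s]" "free_involution_on {p, q, r, s} f"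
  shows "(f p = q \<and> f q = p \<and> f r = s \<and> f s = r) \<or> (f p = r \<and> f r = p \<and> f q = s \<and> f s = q)
    \<or> (f p = s \<and> f s = p \<and> f q = r \<and> f r = q)"
  using assms unfolding free_involution_on_def by auto

text \<open>\<open>p\<close> has five possible partners; the remaining four elements are paired in
  three ways by \<open>free_involution_on_4\<close>, which accounts for all 15 involutions.\<close>

lemma free_involution_on_6:
  assumes d: "distinct [p, q, r, s, u, w]" and f: "free_involution_on {p, q, r, s, u, w} f"
  shows "f p = q \<and> f q = p \<and> free_involution_on {r, s, u, w} f
    \<or> f p = r \<and> f r = p \<and> free_involution_on {q, s, u, w} f
    \<or> f p = s \<and> f s = p \<and> free_involution_on {q, r, u, w} f
    \<or> f p = u \<and> f u = p \<and> free_involution_on {q, r, s, w} f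
    \<or> f p = w \<and> f w = p \<and> free_involution_on {q, r, s, u} f"
proof -
  let ?A = "{p, q, r, s, u, w}"
  note rem = free_involution_on_remove[OF f, of p]
  have "?A - {p, q} = {r, s, u, w}" "?A - {p, r} = {q, s, u, w}" "?A - {p, s} = {q, r, u, w}"
    "?A - {p, u} = {q, r, s, w}" "?A - {p, w} = {q, r, s, u}"
    using d by auto
  moreover have "f p \<in> {q, r, s, u, w}" using rem(1) by auto
  ultimately show ?thesis using rem(2,3) by (elim insertE emptyE) simp_all
qed

lemma ordered_pairs_3:
  "a \<noteq> b \<Longrightarrow> b \<noteq> c \<Longrightarrow> a \<noteq> c \<Longrightarrow>
    ordered_pairs {a, b, c} = {(a, b), (b, c), (c, a), (b, a), (c, b), (a, c)}"
  by (auto simp: ordered_pairs_def)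

lemma eqI_fixed_outside:
  assumes "\<And>x. x \<notin> A \<Longrightarrow> f x = x" "\<And>x. x \<notin> A \<Longrightarrow> g x = x" "\<And>x. x \<in> A \<Longrightarrow> f x = g x"
  shows "f = g"
  using assms by (metis ext)

text \<open>The equation is stated at \<open>D e\<close> because the zigzag defining
  \<open>M (D e)\<close> starts with \<open>e, D e\<close>. As \<open>D\<close> permutes \<Omega>,
  it determines \<open>M\<close> there.\<close>

locale marked_triangle_monodromy = marked_pseudosurface +
  fixes M
  assumes M_rotation: "e \<in> \<Omega> \<Longrightarrow> M (D e) = first_return e"
    and M_outside: "e \<notin> \<Omega> \<Longrightarrow> M e = e"
begin

lemma M_eq: "e \<in> \<Omega> \<Longrightarrow> M e = first_return (D (D e))"
  using M_rotation[of "D (D e)"] rotation by metis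

lemma free_involution_swap_M: "free_involution_on \<Omega> (\<lambda>e. prod.swap (M e))"
  unfolding free_involution_on_def
proof (intro ballI conjI)
  fix e assume e: "e \<in> \<Omega>"
  \<comment> \<open>\<open>D\<close> has order three, so this is the preimage of \<open>e\<close>
    under \<open>D\<close>, and \<open>M e = P ?e0\<close>.\<close>
  let ?e0 = "D (D e)"
  have e0: "?e0 \<in> \<Omega>" "D ?e0 = e" using rotation e by auto
  have M: "M e = first_return ?e0" using M_eq e .
  have r: "M e \<in> \<Omega>" using return_time(2)[OF e0(1)] M by simp
  then show "prod.swap (M e) \<in> \<Omega>" by simp
  show "prod.swap (M e) \<noteq> e" using first_return_neq[OF e0(1)] M e0(2) by (metis swap_swap)
  \<comment> \<open>With \<open>f = - D (M e)\<close> the reversal rule gives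
    \<open>D f = - M e\<close>, hence \<open>M (- M e) = P f = - D ?e0 = - e\<close>.\<close>
  have "prod.swap (D (M e)) \<in> \<Omega>" using rotation(1)[OF r] by simp
  then have "M (D (prod.swap (D (M e)))) = first_return (prod.swap (D (M e)))" by (rule M_rotation)
  also have "\<dots> = prod.swap e" using first_return_reverse[OF e0(1)] M e0(2) by simp
  finally show "prod.swap (M (prod.swap (M e))) = e" using rotation(3)[OF r] by simp
qed

section \<open>The seven permutations on a labelled triangle\<close>

lemma rotation_triangle:
  assumes abc: "t = {a, b, c}"
  shows "D (a, b) = (b, c)" "D (b, c) = (c, a)" "D (c, a) = (a, b)"
    "D (b, a) = (a, c)" "D (a, c) = (c, b)" "D (c, b) = (b, a)"
proof -
  have eqs: "t = {b, c, a}" "t = {c, a, b}" "t = {b, a, c}" "t = {a, c, b}" "t = {c, b, a}"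
    using abc by blast+
  show "D (a, b) = (b, c)" "D (b, c) = (c, a)" "D (c, a) = (a, b)"
    "D (b, a) = (a, c)" "D (a, c) = (c, b)" "D (c, b) = (b, a)"
    using rotation_eq[OF abc] eqs[THEN rotation_eq] by simp_all
qed

lemma inv_rotation: "inv D = D \<circ> D"
proof (rule inv_equality)
  fix e
  have "D (D (D e)) = e" by (cases "e \<in> \<Omega>") (simp_all add: rotation rotation_outside)
  then show "(D \<circ> D) (D e) = e" "D ((D \<circ> D) e) = e" by simp_all
qed

lemma M_eqI:
  assumes "t = {a, b, c}" and "\<And>e. e \<notin> \<Omega> \<Longrightarrow> g e = e"
    and "M (a, b) = g (a, b)" "M (b, c) = g (b, c)" "M (c, a) = g (c, a)"
      "M (b, a) = g (b, a)" "M (c, b) = g (c, b)" "M (a, c) = g (a, c)"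
  shows "M = g"
proof (rule eqI_fixed_outside[of \<Omega>])
  fix e assume "e \<in> \<Omega>"
  moreover have "a \<noteq> b" "b \<noteq> c" "a \<noteq> c" using triangle_distinct t assms(1) by blast+
  ultimately have "e \<in> {(a, b), (b, c), (c, a), (b, a), (c, b), (a, c)}"
    using ordered_pairs_3 assms(1) by metis
  then show "M e = g e" using assms by (elim insertE emptyE) metis+
qed (use assms M_outside in auto)

lemma triangle_ne:
  assumes "t = {a, b, c}"
  shows "a \<noteq> b" "b \<noteq> c" "a \<noteq> c" "b \<noteq> a" "c \<noteq> b" "c \<noteq> a"
  using triangle_distinct[of a b c] t assms by auto

lemma cycle_fixes:
  assumes "t = {a, b, c}" "e \<notin> \<Omega>" "set xs \<subseteq> {(a, b), (b, c), (c, a), (b, a), (c, b), (a, c)}"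
  shows "cycle_of_list xs e = e"
proof (rule id_outside_supp)
  show "e \<notin> set xs" using assms ordered_pairs_3[OF triangle_ne(1-3)[OF assms(1)]] by auto
qed

text \<open>The six values are the two cycles expanded at \<open>e\<^sub>1 = (a, b)\<close>,
  \<open>e\<^sub>2 = (b, c)\<close>, \<open>e\<^sub>3 = (c, a)\<close>.\<close>

lemma M3I:
  assumes abc: "t = {a, b, c}"
    and M: "M (a, b) = (a, c)" "M (b, c) = (c, a)" "M (c, a) = (b, a)"
      "M (b, a) = (b, c)" "M (c, b) = (a, b)" "M (a, c) = (c, b)"
  shows "M3 D M"
proof -
  have "M = cycle_of_list [(b, a), (b, c), (c, a)] \<circ> cycle_of_list [(a, c), (c, b), (a, b)]"
    using M triangle_ne[OF abc]
    \<comment> \<open>The first pass keeps the cycles folded, so that \<open>cycle_fixes\<close> can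
      settle the pairs outside \<Omega>; the second expands them on the six edges.\<close>
    by (intro M_eqI[OF abc]) (simp_all add: cycle_fixes[OF abc] transpose_def
        del: cycle_of_list.simps, simp_all add: transpose_def)
  then show ?thesis
    unfolding M3_def using rotation_triangle[OF abc] triangle_ne[OF abc]
    by (intro exI[of _ "(a, b)"] exI[of _ "(b, c)"] exI[of _ "(c, a)"]) (simp add: cycle3_of_def)
qed

lemma M4I:
  assumes abc: "t = {a, b, c}"
    and M: "M (a, b) = (c, b)" "M (b, c) = (b, a)" "M (c, a) = (c, a)"
      "M (b, a) = (b, c)" "M (c, b) = (a, b)" "M (a, c) = (a, c)"
  shows "M4 D M"
proof -
  have "M = cycle_of_list [(a, b), (c, b)] \<circ> cycle_of_list [(b, c), (b, a)]"
    using M triangle_ne[OF abc]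
    by (intro M_eqI[OF abc]) (simp_all add: cycle_fixes[OF abc] transpose_def
        del: cycle_of_list.simps, simp_all add: transpose_def)
  then show ?thesis
    unfolding M4_def using rotation_triangle[OF abc] triangle_ne[OF abc]
    by (intro exI[of _ "(a, b)"] exI[of _ "(b, c)"] exI[of _ "(c, a)"]) (simp add: cycle3_of_def)
qed

lemma M6I:
  assumes abc: "t = {a, b, c}"
    and M: "M (a, b) = (c, b)" "M (b, c) = (b, a)" "M (c, a) = (b, c)"
      "M (b, a) = (c, a)" "M (c, b) = (a, c)" "M (a, c) = (a, b)"
  shows "M6 D M"
proof -
  have "M = cycle_of_list [(b, a), (c, a), (b, c)] \<circ> cycle_of_list [(c, b), (a, c), (a, b)]"
    using M triangle_ne[OF abc]
    by (intro M_eqI[OF abc]) (simp_all add: cycle_fixes[OF abc] transpose_def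
        del: cycle_of_list.simps, simp_all add: transpose_def)
  then show ?thesis
    unfolding M6_def using rotation_triangle[OF abc] triangle_ne[OF abc]
    \<comment> \<open>A cycle of the inverse rotation, so \<open>(c, a)\<close> comes before
      \<open>(b, c)\<close>.\<close>
    by (intro exI[of _ "(a, b)"] exI[of _ "(c, a)"] exI[of _ "(b, c)"]) (simp add: cycle3_of_def inv_rotation)
qed

lemma M7I:
  assumes abc: "t = {a, b, c}"
    and M: "M (a, b) = (b, c)" "M (b, c) = (a, b)" "M (c, a) = (c, a)"
      "M (b, a) = (c, b)" "M (c, b) = (b, a)" "M (a, c) = (a, c)"
  shows "M7 D M"
proof -
  have "M = cycle_of_list [(a, b), (b, c)] \<circ> cycle_of_list [(b, a), (c, b)]"
    using M triangle_ne[OF abc]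
    by (intro M_eqI[OF abc]) (simp_all add: cycle_fixes[OF abc] transpose_def
        del: cycle_of_list.simps, simp_all add: transpose_def)
  then show ?thesis
    unfolding M7_def using rotation_triangle[OF abc] triangle_ne[OF abc]
    by (intro exI[of _ "(a, b)"] exI[of _ "(b, c)"] exI[of _ "(c, a)"]) (simp add: cycle3_of_def)
qed

lemma M1I:
  assumes abc: "t = {a, b, c}"
    and M: "M (a, b) = (a, b)" "M (b, c) = (b, c)" "M (c, a) = (c, a)"
      "M (b, a) = (b, a)" "M (c, b) = (c, b)" "M (a, c) = (a, c)"
  shows "M1 D M"
  unfolding M1_def using M by (intro M_eqI[OF abc]) simp_all

lemma M2I:
  assumes abc: "t = {a, b, c}"
    and M: "M (a, b) = (b, c)" "M (b, c) = (c, a)" "M (c, a) = (a, b)"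
      "M (b, a) = (a, c)" "M (c, b) = (b, a)" "M (a, c) = (c, b)"
  shows "M2 D M"
  unfolding M2_def using M rotation_triangle[OF abc]
  by (intro M_eqI[OF abc]) (simp_all add: rotation_outside)

lemma M5I:
  assumes abc: "t = {a, b, c}"
    and M: "M (a, b) = (c, a)" "M (b, c) = (a, b)" "M (c, a) = (b, c)"
      "M (b, a) = (c, b)" "M (c, b) = (a, c)" "M (a, c) = (b, a)"
  shows "M5 D M"
  unfolding M5_def inv_rotation using M rotation_triangle[OF abc]
  by (intro M_eqI[OF abc]) (simp_all add: rotation_outside)

theorem monodromy_cases: "M1 D M \<or> M2 D M \<or> M3 D M \<or> M4 D M \<or> M5 D M \<or> M6 D M \<or> M7 D M"
proof -
  obtain a b c where abc: "t = {a, b, c}" using card3[OF t] unfolding card_3_iff by metis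
  note ne = triangle_ne[OF abc]
  \<comment> \<open>Together with \<open>abc\<close> these labellings suffice: (M3), (M4), (M6) and
    (M7) occur three times each, (M1), (M2) and (M5) once, 15 cases in all.\<close>
  have sets: "t = {b, c, a}" "t = {b, a, c}" "t = {a, c, b}" using abc by blast+
  let ?N = "\<lambda>e. prod.swap (M e)"
  have "free_involution_on {(a, b), (b, c), (c, a), (b, a), (c, b), (a, c)} ?N"
    using free_involution_swap_M ordered_pairs_3[OF ne(1-3)] abc by simp
  then have N6: "?N (a, b) = (b, c) \<and> ?N (b, c) = (a, b) \<and> free_involution_on {(c, a), (b, a), (c, b), (a, c)} ?N
    \<or> ?N (a, b) = (c, a) \<and> ?N (c, a) = (a, b) \<and> free_involution_on {(b, c), (b, a), (c, b), (a, c)} ?N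
    \<or> ?N (a, b) = (b, a) \<and> ?N (b, a) = (a, b) \<and> free_involution_on {(b, c), (c, a), (c, b), (a, c)} ?N
    \<or> ?N (a, b) = (c, b) \<and> ?N (c, b) = (a, b) \<and> free_involution_on {(b, c), (c, a), (b, a), (a, c)} ?N
    \<or> ?N (a, b) = (a, c) \<and> ?N (a, c) = (a, b) \<and> free_involution_on {(b, c), (c, a), (b, a), (c, b)} ?N"
    using ne by (intro free_involution_on_6) simp_all
  have swap_eq: "prod.swap e = (x, y) \<longleftrightarrow> e = (y, x)" for e :: "'a \<times> 'a" and x y
    by (cases e) auto
  from N6 show ?thesis
  proof (elim disjE conjE)
    assume "?N (a, b) = (b, c)" "?N (b, c) = (a, b)" and N4: "free_involution_on {(c, a), (b, a), (c, b), (a, c)} ?N"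
    from free_involution_on_4[OF _ N4] this(1,2) show ?thesis
      unfolding swap_eq using ne
        M3I[OF sets(1)] M6I[OF abc] M4I[OF abc]
      by auto
  next
    assume "?N (a, b) = (c, a)" "?N (c, a) = (a, b)" and N4: "free_involution_on {(b, c), (b, a), (c, b), (a, c)} ?N"
    from free_involution_on_4[OF _ N4] this(1,2) show ?thesis
      unfolding swap_eq using ne
        M6I[OF sets(3)] M4I[OF sets(2)] M3I[OF abc]
      by auto
  next
    assume "?N (a, b) = (b, a)" "?N (b, a) = (a, b)" and N4: "free_involution_on {(b, c), (c, a), (c, b), (a, c)} ?N"
    from free_involution_on_4[OF _ N4] this(1,2) show ?thesis
      unfolding swap_eq using ne
        M4I[OF sets(3)] M1I[OF abc] M7I[OF sets(3)]
      by auto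
  next
    assume "?N (a, b) = (c, b)" "?N (c, b) = (a, b)" and N4: "free_involution_on {(b, c), (c, a), (b, a), (a, c)} ?N"
    from free_involution_on_4[OF _ N4] this(1,2) show ?thesis
      unfolding swap_eq using ne
        M3I[OF sets(3)] M7I[OF abc] M2I[OF abc]
      by auto
  next
    assume "?N (a, b) = (a, c)" "?N (a, c) = (a, b)" and N4: "free_involution_on {(b, c), (c, a), (b, a), (c, b)} ?N"
    from free_involution_on_4[OF _ N4] this(1,2) show ?thesis
      unfolding swap_eq using ne
        M6I[OF sets(1)] M5I[OF abc] M7I[OF sets(2)]
      by auto
  qed
qed

section \<open>Counting zigzags by the cycles of the first return\<close>

lemma card_strip_classes_two_cycles:
  assumes \<Omega>: "\<Omega> = {x\<^sub>1, x\<^sub>2, x\<^sub>3, y\<^sub>1, y\<^sub>2, y\<^sub>3}" and y: "y\<^sub>1 \<notin> {x\<^sub>1, x\<^sub>2, x\<^sub>3}"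
    and x_cycle: "first_return x\<^sub>1 = x\<^sub>2" "first_return x\<^sub>2 = x\<^sub>3" "first_return x\<^sub>3 = x\<^sub>1"
    and y_cycle: "first_return y\<^sub>1 = y\<^sub>2" "first_return y\<^sub>2 = y\<^sub>3" "first_return y\<^sub>3 = y\<^sub>1"
  shows "card (strip_class ` \<Omega>) = 2"
proof -
  have mem: "x\<^sub>1 \<in> \<Omega>" "x\<^sub>2 \<in> \<Omega>" "y\<^sub>1 \<in> \<Omega>" "y\<^sub>2 \<in> \<Omega>" using \<Omega> by blast+
  have "strip_class x\<^sub>2 = strip_class x\<^sub>1" "strip_class x\<^sub>3 = strip_class x\<^sub>1"
    "strip_class y\<^sub>2 = strip_class y\<^sub>1" "strip_class y\<^sub>3 = strip_class y\<^sub>1"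
    using mem[THEN strip_class_first_return] x_cycle y_cycle by simp_all
  then have "strip_class ` \<Omega> = {strip_class x\<^sub>1, strip_class y\<^sub>1}" unfolding \<Omega> by simp
  \<comment> \<open>The first cycle is closed under \<open>first_return\<close>, so a strip starting
    in it never enters \<open>t\<close> through \<open>y\<^sub>1\<close>.\<close>
  moreover have "strip_class y\<^sub>1 \<noteq> strip_class x\<^sub>1"
  proof
    assume "strip_class y\<^sub>1 = strip_class x\<^sub>1"
    moreover have "{x\<^sub>1, x\<^sub>2, x\<^sub>3} \<subseteq> \<Omega>" using \<Omega> by blast
    moreover have "first_return e \<in> {x\<^sub>1, x\<^sub>2, x\<^sub>3}" if "e \<in> {x\<^sub>1, x\<^sub>2, x\<^sub>3}" for e
      using that x_cycle by blast
    ultimately have "y\<^sub>1 \<in> {x\<^sub>1, x\<^sub>2, x\<^sub>3}"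
      using strip_class_separation[of "{x\<^sub>1, x\<^sub>2, x\<^sub>3}" x\<^sub>1 y\<^sub>1] mem(3) by blast
    then show False using y by blast
  qed
  ultimately show ?thesis by simp
qed

text \<open>Each fixed point is an invariant set by itself. The two fixed points and any third
  oriented edge therefore have three different classes.\<close>

lemma card_strip_classes_two_fixed:
  assumes x: "x \<in> \<Omega>" "first_return x = x" and y: "y \<in> \<Omega>" "first_return y = y" and "x \<noteq> y"
  shows "card (strip_class ` \<Omega>) \<noteq> 2"
proof -
  obtain a b c where abc: "t = {a, b, c}" using card3[OF t] unfolding card_3_iff by metis
  have \<Omega>: "\<Omega> = {(a, b), (b, c), (c, a), (b, a), (c, b), (a, c)}"
    using ordered_pairs_3[OF triangle_ne(1-3)[OF abc]] abc by simp
  then have fin: "finite \<Omega>" by simp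
  have "\<exists>z\<in>{(a, b), (b, c), (c, a)}. z \<noteq> x \<and> z \<noteq> y" using triangle_ne[OF abc] by auto
  then obtain z where z: "z \<in> \<Omega>" "z \<noteq> x" "z \<noteq> y" using \<Omega> by auto
  have sep: "strip_class w \<noteq> strip_class u"
    if "u \<in> \<Omega>" "first_return u = u" "w \<in> \<Omega>" "w \<noteq> u" for u w
    using strip_class_separation[of "{u}" u w] that by auto
  have "card {strip_class x, strip_class y, strip_class z} = 3"
    using sep[OF x, of y] sep[OF x, of z] sep[OF y, of z] y z \<open>x \<noteq> y\<close>
    by (simp add: card_insert_if)
  moreover have "{strip_class x, strip_class y, strip_class z} \<subseteq> strip_class ` \<Omega>" using x y z by blast
  ultimately have "3 \<le> card (strip_class ` \<Omega>)" using fin by (metis card_mono finite_imageI)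
  then show ?thesis by simp
qed

text \<open>\<open>D\<close> fixes everything outside \<Omega>, so the entries of a genuine 3-cycle
  are oriented edges of \<open>t\<close>, and the first of them labels the triangle.\<close>

lemma cycle3_rotation:
  assumes "cycle3_of D e\<^sub>1 e\<^sub>2 e\<^sub>3"
  obtains a b c where "t = {a, b, c}" "e\<^sub>1 = (a, b)" "e\<^sub>2 = (b, c)" "e\<^sub>3 = (c, a)"
proof -
  have d: "D e\<^sub>1 = e\<^sub>2" "D e\<^sub>2 = e\<^sub>3" "e\<^sub>1 \<noteq> e\<^sub>2" using assms unfolding cycle3_of_def by auto
  then have "e\<^sub>1 \<in> \<Omega>" using rotation_outside by metis
  then obtain a b where ab: "e\<^sub>1 = (a, b)" "a \<in> t" "b \<in> t" "a \<noteq> b" by (auto simp: ordered_pairs_def)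
  obtain c where "t = {a, b, c}" using triangle_third[OF t ab(2-4)] .
  then show ?thesis using that ab(1) d rotation_triangle by metis
qed

lemma first_return_eq: "e \<in> \<Omega> \<Longrightarrow> first_return e = M (D e)"
  using M_rotation by simp

lemma first_return_triangle:
  assumes abc: "t = {a, b, c}"
  shows "first_return (a, b) = M (b, c)" "first_return (b, c) = M (c, a)" "first_return (c, a) = M (a, b)"
    "first_return (b, a) = M (a, c)" "first_return (a, c) = M (c, b)" "first_return (c, b) = M (b, a)"
  using rotation_triangle[OF abc] first_return_eq abc triangle_ne[OF abc] by (auto simp: ordered_pairs_def)

lemma ordered_pairs_t:
  assumes abc: "t = {a, b, c}"
  shows "\<Omega> = {(a, b), (b, c), (c, a), (b, a), (c, b), (a, c)}"
  using ordered_pairs_3[OF triangle_ne(1-3)[OF abc]] abc by simp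

text \<open>Here \<open>P = D\<close>, with one cycle for each orientation of the triangle.\<close>

lemma card_strip_classes_M1:
  assumes "M1 D M"
  shows "card (strip_class ` \<Omega>) = 2"
proof -
  obtain a b c where abc: "t = {a, b, c}" using card3[OF t] unfolding card_3_iff by metis
  show ?thesis
    by (rule card_strip_classes_two_cycles[of "(a, b)" "(b, c)" "(c, a)" "(b, a)" "(a, c)" "(c, b)"])
      (use assms triangle_ne[OF abc] ordered_pairs_t[OF abc] in
        \<open>auto simp: first_return_triangle[OF abc] M1_def\<close>)
qed

text \<open>Here \<open>P = D \<circ> D\<close>, whose cycles are those of \<open>D\<close> run
  backwards.\<close>

lemma card_strip_classes_M2:
  assumes "M2 D M"
  shows "card (strip_class ` \<Omega>) = 2"
proof -
  obtain a b c where abc: "t = {a, b, c}" using card3[OF t] unfolding card_3_iff by metis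
  show ?thesis
    by (rule card_strip_classes_two_cycles[of "(a, b)" "(c, a)" "(b, c)" "(b, a)" "(c, b)" "(a, c)"])
      (use assms triangle_ne[OF abc] ordered_pairs_t[OF abc] in
        \<open>auto simp: first_return_triangle[OF abc] rotation_triangle[OF abc] M2_def\<close>)
qed

lemma card_strip_classes_M3:
  assumes "M3 D M"
  shows "card (strip_class ` \<Omega>) = 2"
proof -
  obtain e\<^sub>1 e\<^sub>2 e\<^sub>3 where D: "cycle3_of D e\<^sub>1 e\<^sub>2 e\<^sub>3"
    and M: "M = cycle_of_list [prod.swap e\<^sub>1, e\<^sub>2, e\<^sub>3] \<circ> cycle_of_list [prod.swap e\<^sub>3, prod.swap e\<^sub>2, e\<^sub>1]"
    using assms unfolding M3_def by blast
  obtain a b c where abc: "t = {a, b, c}" and e: "e\<^sub>1 = (a, b)" "e\<^sub>2 = (b, c)" "e\<^sub>3 = (c, a)"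
    using cycle3_rotation[OF D] .
  have "M (a, b) = (a, c)" "M (b, c) = (c, a)" "M (c, a) = (b, a)"
    "M (b, a) = (b, c)" "M (c, b) = (a, b)" "M (a, c) = (c, b)"
    using triangle_ne[OF abc] by (simp_all add: M e transpose_def)
  then show ?thesis
    by (intro card_strip_classes_two_cycles[of "(a, b)" "(c, a)" "(a, c)" "(b, c)" "(b, a)" "(c, b)"])
      (use triangle_ne[OF abc] ordered_pairs_t[OF abc] in \<open>auto simp: first_return_triangle[OF abc]\<close>)
qed

lemma card_strip_classes_M4:
  assumes "M4 D M"
  shows "card (strip_class ` \<Omega>) = 2"
proof -
  obtain e\<^sub>1 e\<^sub>2 e\<^sub>3 where D: "cycle3_of D e\<^sub>1 e\<^sub>2 e\<^sub>3"
    and M: "M = cycle_of_list [e\<^sub>1, prod.swap e\<^sub>2] \<circ> cycle_of_list [e\<^sub>2, prod.swap e\<^sub>1]"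
    using assms unfolding M4_def by blast
  obtain a b c where abc: "t = {a, b, c}" and e: "e\<^sub>1 = (a, b)" "e\<^sub>2 = (b, c)" "e\<^sub>3 = (c, a)"
    using cycle3_rotation[OF D] .
  have "M (a, b) = (c, b)" "M (b, c) = (b, a)" "M (c, a) = (c, a)"
    "M (b, a) = (b, c)" "M (c, b) = (a, b)" "M (a, c) = (a, c)"
    using triangle_ne[OF abc] by (simp_all add: M e transpose_def)
  then show ?thesis
    by (intro card_strip_classes_two_cycles[of "(a, b)" "(b, a)" "(a, c)" "(b, c)" "(c, a)" "(c, b)"])
      (use triangle_ne[OF abc] ordered_pairs_t[OF abc] in \<open>auto simp: first_return_triangle[OF abc]\<close>)
qed

text \<open>Here \<open>P\<close> is the identity on \<Omega>; two of its fixed points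
  suffice.\<close>

lemma card_strip_classes_M5:
  assumes "M5 D M"
  shows "card (strip_class ` \<Omega>) \<noteq> 2"
proof -
  obtain a b c where abc: "t = {a, b, c}" using card3[OF t] unfolding card_3_iff by metis
  show ?thesis
    by (rule card_strip_classes_two_fixed[of "(a, b)" "(b, a)"])
      (use assms triangle_ne[OF abc] ordered_pairs_t[OF abc] in
        \<open>auto simp: first_return_triangle[OF abc] rotation_triangle[OF abc] M5_def inv_rotation\<close>)
qed

lemma card_strip_classes_M6:
  assumes "M6 D M"
  shows "card (strip_class ` \<Omega>) \<noteq> 2"
proof -
  obtain e\<^sub>1 e\<^sub>2 e\<^sub>3 where D: "cycle3_of (inv D) e\<^sub>1 e\<^sub>2 e\<^sub>3"
    and M: "M = cycle_of_list [prod.swap e\<^sub>1, e\<^sub>2, e\<^sub>3] \<circ> cycle_of_list [prod.swap e\<^sub>3, prod.swap e\<^sub>2, e\<^sub>1]"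
    using assms unfolding M6_def by blast
  have D3: "D (D (D e)) = e" for e by (cases "e \<in> \<Omega>") (simp_all add: rotation rotation_outside)
  \<comment> \<open>Reversing the cycle of the inverse rotation makes \<open>cycle3_rotation\<close>
    applicable, hence the exchanged roles of \<open>e\<^sub>2\<close> and
    \<open>e\<^sub>3\<close>.\<close>
  have "cycle3_of D e\<^sub>1 e\<^sub>3 e\<^sub>2"
    using D unfolding cycle3_of_def inv_rotation comp_apply by (simp, metis D3)
  then obtain a b c where abc: "t = {a, b, c}" and e: "e\<^sub>1 = (a, b)" "e\<^sub>3 = (b, c)" "e\<^sub>2 = (c, a)"
    by (rule cycle3_rotation)
  have "M (c, a) = (b, c)" "M (c, b) = (a, c)"
    using triangle_ne[OF abc] by (simp_all add: M e transpose_def)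
  then show ?thesis
    by (intro card_strip_classes_two_fixed[of "(b, c)" "(a, c)"])
      (use triangle_ne[OF abc] ordered_pairs_t[OF abc] in \<open>auto simp: first_return_triangle[OF abc]\<close>)
qed

lemma card_strip_classes_M7:
  assumes "M7 D M"
  shows "card (strip_class ` \<Omega>) \<noteq> 2"
proof -
  obtain e\<^sub>1 e\<^sub>2 e\<^sub>3 where D: "cycle3_of D e\<^sub>1 e\<^sub>2 e\<^sub>3"
    and M: "M = cycle_of_list [e\<^sub>1, e\<^sub>2] \<circ> cycle_of_list [prod.swap e\<^sub>1, prod.swap e\<^sub>2]"
    using assms unfolding M7_def by blast
  obtain a b c where abc: "t = {a, b, c}" and e: "e\<^sub>1 = (a, b)" "e\<^sub>2 = (b, c)" "e\<^sub>3 = (c, a)"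
    using cycle3_rotation[OF D] .
  have "M (b, c) = (a, b)" "M (b, a) = (c, b)"
    using triangle_ne[OF abc] by (simp_all add: M e transpose_def)
  then show ?thesis
    by (intro card_strip_classes_two_fixed[of "(a, b)" "(c, b)"])
      (use triangle_ne[OF abc] ordered_pairs_t[OF abc] in \<open>auto simp: first_return_triangle[OF abc]\<close>)
qed

theorem two_strip_classes_iff:
  "card (strip_class ` \<Omega>) = 2 \<longleftrightarrow> M1 D M \<or> M2 D M \<or> M3 D M \<or> M4 D M"
  using monodromy_cases card_strip_classes_M1 card_strip_classes_M2 card_strip_classes_M3
    card_strip_classes_M4 card_strip_classes_M5 card_strip_classes_M6 card_strip_classes_M7
  by blast

end

section \<open>Faces of a triangulation\<close>

locale triangulation =
  fixes \<Gamma> :: "('a::t2_space) embedded_graph"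
  assumes tri: "surface_triangulation \<Gamma>"
begin

section \<open>The embedded graph and the boundary of a face\<close>

lemma closed_surface: "closed_surface (surface \<Gamma>)"
  using tri unfolding surface_triangulation_def by blast

lemma embedded: "embedded_simple_graph \<Gamma>"
  using tri unfolding surface_triangulation_def by blast

lemma edge_arc:
  assumes "e \<in> edges \<Gamma>"
  shows "\<exists>\<gamma>. arc \<gamma> \<and> path_image \<gamma> = e \<and> e \<inter> verts \<Gamma> = {pathstart \<gamma>, pathfinish \<gamma>}"
  using embedded assms by (simp add: embedded_simple_graph_def)

lemma edge_ends:
  assumes "e \<in> edges \<Gamma>"
  obtains x y where "x \<noteq> y" "e \<inter> verts \<Gamma> = {x, y}"
proof -
  obtain \<gamma> where "arc \<gamma>" "e \<inter> verts \<Gamma> = {pathstart \<gamma>, pathfinish \<gamma>}"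
    using edge_arc[OF assms] by blast
  then show ?thesis using that[of "pathstart \<gamma>" "pathfinish \<gamma>"] arc_distinct_ends[of \<gamma>] by simp
qed

lemma closed_edge:
  assumes "e \<in> edges \<Gamma>"
  shows "closed e"
proof -
  obtain \<gamma> where "arc \<gamma>" "path_image \<gamma> = e"
    using edge_arc[OF assms] by blast
  then show ?thesis using compact_arc_image compact_imp_closed by blast
qed

lemma edges_Int: "e \<in> edges \<Gamma> \<Longrightarrow> e' \<in> edges \<Gamma> \<Longrightarrow> e \<noteq> e' \<Longrightarrow> e \<inter> e' \<subseteq> verts \<Gamma>"
  using embedded by (simp add: embedded_simple_graph_def)

lemma edge_eqI: "e \<in> edges \<Gamma> \<Longrightarrow> e' \<in> edges \<Gamma> \<Longrightarrow> e \<inter> verts \<Gamma> = e' \<inter> verts \<Gamma> \<Longrightarrow> e = e'"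
  using embedded by (simp add: embedded_simple_graph_def)

lemma edge_subset_eq:
  assumes "e \<in> edges \<Gamma>" "e' \<in> edges \<Gamma>" "e \<subseteq> e'"
  shows "e = e'"
proof -
  obtain x y x' y' where "x \<noteq> y" "e \<inter> verts \<Gamma> = {x, y}" "x' \<noteq> y'" "e' \<inter> verts \<Gamma> = {x', y'}"
    using edge_ends assms(1,2) by metis
  moreover from this have "{x, y} \<subseteq> {x', y'}" using assms(3) by blast
  ultimately have "e \<inter> verts \<Gamma> = e' \<inter> verts \<Gamma>" by auto
  then show ?thesis using edge_eqI assms(1,2) by blast
qed

lemma closed_graph: "closed (verts \<Gamma> \<union> \<Union>(edges \<Gamma>))"
  using embedded closed_edge unfolding embedded_simple_graph_def
  by (intro closed_Un closed_Union finite_imp_closed) auto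

lemma openin_graph_complement:
  "openin (top_of_set (surface \<Gamma>)) (surface \<Gamma> - (verts \<Gamma> \<union> \<Union>(edges \<Gamma>)))"
  unfolding Diff_eq using closed_graph by (intro openin_open_Int open_Compl)

lemma openin_face_component:
  "C \<in> components (surface \<Gamma> - (verts \<Gamma> \<union> \<Union>(edges \<Gamma>))) \<Longrightarrow> openin (top_of_set (surface \<Gamma>)) C"
  using openin_component closed_surface openin_graph_complement by blast

lemma face_subset_surface: "F \<in> faces \<Gamma> \<Longrightarrow> F \<subseteq> surface \<Gamma>"
proof -
  assume "F \<in> faces \<Gamma>"
  then obtain C where "C \<in> components (surface \<Gamma> - (verts \<Gamma> \<union> \<Union>(edges \<Gamma>)))" "F = closure C"
    unfolding faces_def by blast
  moreover have "closed (surface \<Gamma>)"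
    using closed_surface compact_imp_closed unfolding closed_surface_def by blast
  ultimately show ?thesis using in_components_subset closure_minimal by blast
qed

lemma card_face_edges: "F \<in> faces \<Gamma> \<Longrightarrow> card {e \<in> edges \<Gamma>. e \<subseteq> F} = 3"
  using tri unfolding surface_triangulation_def by blast

lemma card_edge_faces: "e \<in> edges \<Gamma> \<Longrightarrow> card {F \<in> faces \<Gamma>. e \<subseteq> F} = 2"
  using tri unfolding surface_triangulation_def by blast

lemma faces_Int:
  assumes "F \<in> faces \<Gamma>" "F' \<in> faces \<Gamma>" "F \<noteq> F'"
  shows "F \<inter> F' \<in> edges \<Gamma> \<or> (\<exists>v\<in>verts \<Gamma>. F \<inter> F' = {v}) \<or> F \<inter> F' = {}"
  using tri assms by (simp add: surface_triangulation_def)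

lemma openin_meets_closure:
  assumes "openin (top_of_set (surface \<Gamma>)) B" "p \<in> B" "p \<in> closure C" "C \<subseteq> surface \<Gamma>"
  shows "B \<inter> C \<noteq> {}"
proof -
  obtain Q where "open Q" "B = surface \<Gamma> \<inter> Q" using assms(1) unfolding openin_open by blast
  moreover from this have "Q \<inter> C \<noteq> {}"
    using assms(2,3) open_Int_closure_eq_empty by blast
  ultimately show ?thesis using assms(4) by blast
qed

text \<open>Either \<open>v\<close> lies on \<open>e\<close>, or a path in the connected graph from
  \<open>v\<close> to an end of \<open>e\<close> has a first edge, which contains
  \<open>v\<close>.\<close>

lemma vertex_on_edge:
  assumes v: "v \<in> verts \<Gamma>" and e: "e \<in> edges \<Gamma>"
  shows "\<exists>e'\<in>edges \<Gamma>. v \<in> e'"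
proof (cases "v \<in> e")
  case False
  obtain x y where xy: "x \<noteq> y" "e \<inter> verts \<Gamma> = {x, y}" using edge_ends e by blast
  then have "x \<noteq> v" "x \<in> verts \<Gamma>" using False by blast+
  have "connected_graph \<Gamma>" using tri by (simp add: surface_triangulation_def)
  then have "(v, x) \<in> {(u, w). \<exists>e. joins \<Gamma> e u w}\<^sup>*"
    using v \<open>x \<in> verts \<Gamma>\<close> by (simp add: connected_graph_def)
  then obtain w where "(v, w) \<in> {(u, w). \<exists>e. joins \<Gamma> e u w}"
    using \<open>x \<noteq> v\<close> by (cases rule: converse_rtranclE) blast+
  then show ?thesis unfolding joins_def by blast
qed (use e in blast)

text \<open>An edge through an interior point \<open>p\<close> of the disc \<open>F\<close> would lie in no face but \<open>F\<close>, because a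
  face through \<open>p\<close> meets the open set \<open>f -` ball 0 1\<close> in which the component of \<open>F\<close> is dense.\<close>

lemma face_boundary:
  assumes F: "F \<in> faces \<Gamma>"
  obtains f f' where "homeomorphism F (cball (0 :: real ^ 2) 1) f f'"
    and "{p \<in> F. f p \<in> sphere 0 1} = F \<inter> \<Union>(edges \<Gamma>)"
proof -
  let ?S = "surface \<Gamma>" and ?G = "verts \<Gamma> \<union> \<Union>(edges \<Gamma>)"
  obtain C where C: "C \<in> components (?S - ?G)" and FC: "F = closure C"
    using F unfolding faces_def by blast
  have oC: "openin (top_of_set ?S) C" using openin_face_component C by blast
  have CF: "C \<subseteq> F" using FC closure_subset by blast
  \<comment> \<open>Components are open in the surface, so one that meets the closure of
    \<open>C\<close> meets \<open>C\<close> itself.\<close>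
  have same: "C' = C" if C': "C' \<in> components (?S - ?G)" and m: "C' \<inter> F \<noteq> {}" for C'
  proof -
    have "openin (top_of_set ?S) C'" using openin_face_component C' by blast
    moreover have "C \<subseteq> ?S" using C in_components_subset by blast
    ultimately have "C' \<inter> C \<noteq> {}" using openin_meets_closure m FC by blast
    then show ?thesis using components_nonoverlap C C' by blast
  qed
  have "F homeomorphic cball (0 :: real ^ 2) 1"
    using tri F by (simp add: surface_triangulation_def)
  then obtain f f' where f: "homeomorphism F (cball (0 :: real ^ 2) 1) f f'"
    unfolding homeomorphic_def by blast
  \<comment> \<open>The inner disc of \<open>F\<close> (not the rotation); it is open in the surface
    by invariance of domain.\<close>
  define D where "D = {p \<in> F. f p \<in> ball 0 1}"
  have fD: "f ` D = ball 0 1"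
  proof
    show "ball 0 1 \<subseteq> f ` D"
    proof
      fix y :: "real ^ 2" assume "y \<in> ball 0 1"
      then have "y = f (f' y)" "f' y \<in> F" using f by (auto simp: homeomorphism_def)
      with \<open>y \<in> ball 0 1\<close> show "y \<in> f ` D" unfolding D_def by (metis (mono_tags, lifting) imageI mem_Collect_eq)
    qed
  qed (auto simp: D_def)
  have "D homeomorphic ball (0 :: real ^ 2) 1"
    using homeomorphism_of_subsets[OF f, of D "ball 0 1"] fD
    unfolding homeomorphic_def D_def by auto
  then have oD: "openin (top_of_set ?S) D"
    using openin_surface_if_homeomorphic_open closed_surface face_subset_surface[OF F]
    unfolding D_def by (metis (no_types, lifting) mem_Collect_eq open_ball subset_iff)
  have CD: "C \<subseteq> D"
    using surface_open_subset_of_disc[OF closed_surface oC CF f] CF unfolding D_def by blast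
  have De: "D \<inter> e = {}" if e: "e \<in> edges \<Gamma>" for e
  proof (rule ccontr)
    assume "D \<inter> e \<noteq> {}"
    then obtain p where p: "p \<in> D" "p \<in> e" by blast
    have "F' = F" if F': "F' \<in> faces \<Gamma>" "e \<subseteq> F'" for F'
    proof -
      obtain C' where C': "C' \<in> components (?S - ?G)" "F' = closure C'"
        using F' unfolding faces_def by blast
      moreover have "C' \<subseteq> ?S" using C'(1) in_components_subset by blast
      ultimately have "D \<inter> C' \<noteq> {}" using openin_meets_closure oD p F'(2) by blast
      then show ?thesis using same[OF C'(1)] C'(2) FC D_def by blast
    qed
    then have "{F \<in> faces \<Gamma>. e \<subseteq> F} \<subseteq> {F}" by blast
    then have "card {F \<in> faces \<Gamma>. e \<subseteq> F} \<le> 1"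
      by (metis card.empty card_insert_disjoint card_mono empty_iff finite.emptyI finite_insert One_nat_def)
    then show False using card_edge_faces[OF e] by simp
  qed
  \<comment> \<open>Once an edge exists every vertex lies on one, so the embedded graph is just the
    union of its edges.\<close>
  have "edges \<Gamma> \<noteq> {}" using card_face_edges[OF F] by fastforce
  then have "?G = \<Union>(edges \<Gamma>)" using vertex_on_edge by blast
  moreover have "F - C \<subseteq> ?G"
  proof
    fix p assume p: "p \<in> F - C"
    show "p \<in> ?G"
    proof (rule ccontr)
      assume "p \<notin> ?G"
      then have "p \<in> ?S - ?G" using p face_subset_surface[OF F] by blast
      then obtain C' where "C' \<in> components (?S - ?G)" "p \<in> C'"
        by (metis Union_components UnionE)
      then show False using same p by blast
    qed
  qed
  moreover have "f p \<in> sphere 0 1 \<longleftrightarrow> p \<notin> D" if "p \<in> F" for p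
  proof -
    have "f p \<in> cball 0 1" using f that by (auto simp: homeomorphism_def)
    then show ?thesis using that unfolding D_def by auto
  qed
  ultimately have "{p \<in> F. f p \<in> sphere 0 1} = F \<inter> \<Union>(edges \<Gamma>)"
    using De CD D_def by blast
  then show ?thesis by (rule that[OF f])
qed

text \<open>The boundary circle consists of the edges in \<open>F\<close> and finitely many vertices; a circle has no
  isolated points.\<close>

lemma face_Int_edges:
  assumes F: "F \<in> faces \<Gamma>"
  shows "F \<inter> \<Union>(edges \<Gamma>) = \<Union>{e \<in> edges \<Gamma>. e \<subseteq> F}"
    and "p \<in> F \<inter> \<Union>(edges \<Gamma>) \<Longrightarrow> connected (F \<inter> \<Union>(edges \<Gamma>) - {p})"
proof -
  let ?B = "F \<inter> \<Union>(edges \<Gamma>)" and ?K = "\<Union>{e \<in> edges \<Gamma>. e \<subseteq> F}"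
  obtain f f' where f: "homeomorphism F (cball (0 :: real ^ 2) 1) f f'"
    and B: "{p \<in> F. f p \<in> sphere 0 1} = ?B"
    using face_boundary[OF F] by metis
  have fB: "f ` ?B = sphere 0 1"
  proof
    show "sphere 0 1 \<subseteq> f ` ?B"
    proof
      fix y :: "real ^ 2" assume "y \<in> sphere 0 1"
      then have "y = f (f' y)" "f' y \<in> F" using f by (auto simp: homeomorphism_def)
      with \<open>y \<in> sphere 0 1\<close> show "y \<in> f ` ?B" unfolding B[symmetric] by (metis (mono_tags, lifting) imageI mem_Collect_eq)
    qed
  qed (use B in blast)
  then have hom: "homeomorphism ?B (sphere 0 1) f f'"
    using homeomorphism_of_subsets[OF f, of ?B "sphere 0 1"] by auto
  have fin: "finite (verts \<Gamma>)" "finite (edges \<Gamma>)"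
    using embedded unfolding embedded_simple_graph_def by auto
  \<comment> \<open>Such a point lies on an edge outside \<open>F\<close>, hence in a second face
    \<open>F'\<close>; the edge meets \<open>F \<inter> F'\<close> in vertices only.\<close>
  have BK: "?B - ?K \<subseteq> verts \<Gamma>"
  proof
    fix p assume p: "p \<in> ?B - ?K"
    then obtain e where e: "e \<in> edges \<Gamma>" "p \<in> e" "\<not> e \<subseteq> F" by blast
    then have "{F \<in> faces \<Gamma>. e \<subseteq> F} \<noteq> {}"
      using card_edge_faces[OF e(1)] by (metis card.empty zero_neq_numeral)
    then obtain F' where F': "F' \<in> faces \<Gamma>" "e \<subseteq> F'" by blast
    then have "F \<noteq> F'" using e(3) by blast
    from faces_Int[OF F F'(1) this] have "F \<inter> F' \<in> edges \<Gamma> \<or> F \<inter> F' \<subseteq> verts \<Gamma>"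
      by (elim disjE bexE) simp_all
    then show "p \<in> verts \<Gamma>"
    proof
      assume "F \<inter> F' \<in> edges \<Gamma>"
      moreover have "e \<noteq> F \<inter> F'" using e(3) by blast
      ultimately have "e \<inter> (F \<inter> F') \<subseteq> verts \<Gamma>" using edges_Int e(1) by blast
      then show ?thesis using p e(2) F'(2) by blast
    qed (use p e(2) F'(2) in blast)
  qed
  have conn: "connected ?B"
    using hom homeomorphic_connectedness[of ?B "sphere (0 :: real ^ 2) 1"]
    by (auto simp: homeomorphic_def connected_sphere)
  have inf: "infinite ?B" using infinite_circle fB finite_imageI by metis
  have "?K \<subseteq> ?B" by blast
  show eq: "?B = ?K"
  \<comment> \<open>The connected boundary would split into two nonempty closed parts, the edges in
    \<open>F\<close> and a finite remainder. The first is nonempty because the circle is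
    infinite.\<close>
  proof (rule ccontr)
    assume "?B \<noteq> ?K"
    have "closed ?K" using closed_edge fin(2) by (intro closed_Union) auto
    moreover have "closed (?B - ?K)" using BK fin(1) by (metis finite_imp_closed finite_subset)
    moreover have "?K \<noteq> {}"
      using inf BK fin(1) by (metis Diff_empty finite_subset)
    ultimately show False
      using conn \<open>?K \<subseteq> ?B\<close> \<open>?B \<noteq> ?K\<close> unfolding connected_closed by blast
  qed
  assume p: "p \<in> ?B"
  have "inj_on f ?B" using hom unfolding homeomorphism_def by (metis inj_on_inverseI)
  then have "f ` (?B - {p}) = sphere 0 1 - {f p}"
    using inj_on_image_set_diff[of f ?B ?B "{p}"] p fB by auto
  then have "homeomorphism (?B - {p}) (sphere 0 1 - {f p}) f f'"
    by (intro homeomorphism_of_subsets[OF hom, where T'' = "sphere 0 1 - {f p}"]) auto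
  moreover have "connected (sphere 0 1 - {f p})"
    using connected_circle_minus_point fB p by blast
  ultimately show "connected (?B - {p})"
    using homeomorphic_connectedness homeomorphic_def by blast
qed

text \<open>Remove the other end \<open>y\<close> of \<open>e\<close> from the boundary circle. If
  \<open>x\<close> were on no other edge of the face, \<open>e\<close> and the union of the others
  would disconnect the punctured circle.\<close>

lemma face_edge_ends:
  assumes F: "F \<in> faces \<Gamma>" and E: "{e \<in> edges \<Gamma>. e \<subseteq> F} = insert e E" "e \<notin> E" "E \<noteq> {}"
    and x: "x \<in> e" "x \<in> verts \<Gamma>"
  shows "\<exists>e'\<in>E. x \<in> e'"
proof (rule ccontr)
  assume nx: "\<not> (\<exists>e'\<in>E. x \<in> e')"
  have e: "e \<in> edges \<Gamma>" and E': "E \<subseteq> edges \<Gamma>" using E(1) by blast+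
  obtain u w where uw: "u \<noteq> w" "e \<inter> verts \<Gamma> = {u, w}" using edge_ends[OF e] by metis
  then have "x = u \<or> x = w" using x by blast
  then obtain y where y: "x \<noteq> y" "e \<inter> verts \<Gamma> = {x, y}"
    using uw by (metis insert_commute)
  let ?B = "F \<inter> \<Union>(edges \<Gamma>)"
  have B: "?B = e \<union> \<Union>E" using face_Int_edges(1)[OF F] E(1) by simp
  have "y \<in> e" using y(2) by blast
  then have conn: "connected (?B - {y})" using face_Int_edges(2)[OF F] B by blast
  have "finite E"
    using E(1) embedded finite_subset[of E "edges \<Gamma>"] E' by (simp add: embedded_simple_graph_def)
  then have cl: "closed (\<Union>E)" using closed_edge E' by (intro closed_Union) auto
  have cov: "?B - {y} \<subseteq> e \<union> \<Union>E" using B by blast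
  have "e \<inter> \<Union>E \<subseteq> {x, y}" using edges_Int[OF e] y(2) E(2) E' by blast
  then have disj: "e \<inter> \<Union>E \<inter> (?B - {y}) = {}" using nx by blast
  have ne: "e \<inter> (?B - {y}) \<noteq> {}" using x(1) y(1) B by blast
  \<comment> \<open>An edge in \<open>E\<close> has two ends, so one of them survives the removal of
    \<open>y\<close>.\<close>
  obtain e' where e': "e' \<in> E" using E(3) by blast
  then obtain u' w' where uw': "u' \<noteq> w'" "e' \<inter> verts \<Gamma> = {u', w'}" using edge_ends E' by blast
  then have "u' \<in> \<Union>E" "w' \<in> \<Union>E" using e' by blast+
  moreover have "u' \<noteq> y \<or> w' \<noteq> y" using uw'(1) by metis
  moreover have "\<Union>E \<subseteq> ?B" using B by simp
  ultimately have ne': "\<Union>E \<inter> (?B - {y}) \<noteq> {}" by (elim disjE) blast+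
  show False using connected_closedD[OF conn disj cov closed_edge[OF e] cl] ne ne' by blast
qed

section \<open>Faces as vertex triples\<close>

lemma joins_distinct: "joins \<Gamma> e x y \<Longrightarrow> x \<noteq> y"
  using edge_ends unfolding joins_def by (metis doubleton_eq_iff)

lemma joins_sym: "joins \<Gamma> e x y \<Longrightarrow> joins \<Gamma> e y x"
  by (simp add: joins_def insert_commute)

lemma joins_unique: "joins \<Gamma> e x y \<Longrightarrow> joins \<Gamma> e' x y \<Longrightarrow> e = e'"
  unfolding joins_def using edge_eqI by simp

lemma joins_mem: "joins \<Gamma> e x y \<Longrightarrow> e \<subseteq> F \<Longrightarrow> x \<in> verts \<Gamma> \<inter> F \<and> y \<in> verts \<Gamma> \<inter> F"
  unfolding joins_def by blast

text \<open>By \<open>face_edge_ends\<close> each end of \<open>e\<^sub>1\<close> lies on another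
  edge, and by simplicity the two ends lie on different ones. The far end \<open>c\<close> of the
  second edge must then be the far end of the third.\<close>

lemma face_triangle:
  assumes F: "F \<in> faces \<Gamma>"
  obtains a b c e\<^sub>1 e\<^sub>2 e\<^sub>3 where "verts \<Gamma> \<inter> F = {a, b, c}" "a \<noteq> b" "b \<noteq> c" "a \<noteq> c"
    "e\<^sub>1 \<subseteq> F" "e\<^sub>2 \<subseteq> F" "e\<^sub>3 \<subseteq> F" "joins \<Gamma> e\<^sub>1 a b" "joins \<Gamma> e\<^sub>2 b c" "joins \<Gamma> e\<^sub>3 c a"
proof -
  note triangleI = that
  obtain e\<^sub>1 e\<^sub>2 e\<^sub>3 where E: "{e \<in> edges \<Gamma>. e \<subseteq> F} = {e\<^sub>1, e\<^sub>2, e\<^sub>3}"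
    and d: "e\<^sub>1 \<noteq> e\<^sub>2" "e\<^sub>2 \<noteq> e\<^sub>3" "e\<^sub>1 \<noteq> e\<^sub>3"
    using card_face_edges[OF F] unfolding card_3_iff by metis
  have e: "e\<^sub>1 \<in> edges \<Gamma>" "e\<^sub>2 \<in> edges \<Gamma>" "e\<^sub>3 \<in> edges \<Gamma>" "e\<^sub>1 \<subseteq> F" "e\<^sub>2 \<subseteq> F" "e\<^sub>3 \<subseteq> F" using E by blast+
  \<comment> \<open>Stated for an arbitrary labelling, since \<open>e\<^sub>2\<close> and
    \<open>e\<^sub>3\<close> may have to be exchanged below.\<close>
  have triangle: thesis
    if E: "{e \<in> edges \<Gamma>. e \<subseteq> F} = {e\<^sub>1, e\<^sub>2, e\<^sub>3}" and d: "e\<^sub>1 \<noteq> e\<^sub>2" "e\<^sub>2 \<noteq> e\<^sub>3" "e\<^sub>1 \<noteq> e\<^sub>3"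
      and ab: "joins \<Gamma> e\<^sub>1 a b" "a \<in> e\<^sub>3" "b \<in> e\<^sub>2" for e\<^sub>1 e\<^sub>2 e\<^sub>3 a b
  proof -
    have e: "e\<^sub>1 \<in> edges \<Gamma>" "e\<^sub>2 \<in> edges \<Gamma>" "e\<^sub>3 \<in> edges \<Gamma>" "e\<^sub>1 \<subseteq> F" "e\<^sub>2 \<subseteq> F" "e\<^sub>3 \<subseteq> F"
      using E by blast+
    have abV: "a \<in> verts \<Gamma>" "b \<in> verts \<Gamma>" "a \<noteq> b" using ab joins_distinct unfolding joins_def by blast+
    obtain u w where uw: "u \<noteq> w" "e\<^sub>2 \<inter> verts \<Gamma> = {u, w}" using edge_ends[OF e(2)] by metis
    then have "b = u \<or> b = w" using ab abV by blast
    then obtain c where c: "b \<noteq> c" "joins \<Gamma> e\<^sub>2 b c" using uw e(2) unfolding joins_def by (metis insert_commute)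
    obtain u' w' where uw': "u' \<noteq> w'" "e\<^sub>3 \<inter> verts \<Gamma> = {u', w'}" using edge_ends[OF e(3)] by metis
    then have "a = u' \<or> a = w'" using ab abV by blast
    then obtain d' where d': "a \<noteq> d'" "joins \<Gamma> e\<^sub>3 a d'" using uw' e(3) unfolding joins_def by (metis insert_commute)
    have ac: "a \<noteq> c" using joins_unique[OF ab(1) joins_sym] c(2) d(1) by blast
    have "c \<in> e\<^sub>2" "c \<in> verts \<Gamma>" using c(2) unfolding joins_def by blast+
    then have "\<exists>e'\<in>{e\<^sub>1, e\<^sub>3}. c \<in> e'" using face_edge_ends[OF F, of e\<^sub>2 "{e\<^sub>1, e\<^sub>3}" c] E d by auto
    moreover have "c \<notin> e\<^sub>1" using ab(1) ac c(1) \<open>c \<in> verts \<Gamma>\<close> unfolding joins_def by auto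
    ultimately have "c = d'" using d'(2) ac \<open>c \<in> verts \<Gamma>\<close> unfolding joins_def by auto
    then have ca: "joins \<Gamma> e\<^sub>3 c a" using d'(2) joins_sym by blast
    have "verts \<Gamma> \<inter> F \<subseteq> F \<inter> \<Union>(edges \<Gamma>)" using vertex_on_edge e(1) by blast
    then have "verts \<Gamma> \<inter> F = verts \<Gamma> \<inter> (e\<^sub>1 \<union> e\<^sub>2 \<union> e\<^sub>3)"
      using face_Int_edges(1)[OF F] E by auto
    also have "\<dots> = {a, b, c}" using ab(1) c(2) ca unfolding joins_def by blast
    finally show thesis by (rule triangleI) (fact abV(3) c(1) ac e(4-6) ab(1) c(2) ca)+
  qed
  obtain a b where ab: "joins \<Gamma> e\<^sub>1 a b" using edge_ends[OF e(1)] e(1) unfolding joins_def by metis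
  then have abe: "a \<in> e\<^sub>1" "a \<in> verts \<Gamma>" "b \<in> e\<^sub>1" "b \<in> verts \<Gamma>" "a \<noteq> b"
    using joins_distinct unfolding joins_def by blast+
  have "a \<in> e\<^sub>2 \<or> a \<in> e\<^sub>3" "b \<in> e\<^sub>2 \<or> b \<in> e\<^sub>3"
    using face_edge_ends[OF F, of e\<^sub>1 "{e\<^sub>2, e\<^sub>3}"] E d abe by auto
  moreover have "\<not> (a \<in> e' \<and> b \<in> e')" if e': "e' \<in> edges \<Gamma>" "e\<^sub>1 \<noteq> e'" for e'
  proof
    assume "a \<in> e' \<and> b \<in> e'"
    then have "{a, b} \<subseteq> e' \<inter> verts \<Gamma>" using abe by blast
    moreover obtain u w where "e' \<inter> verts \<Gamma> = {u, w}" using edge_ends[OF e'(1)] by metis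
    ultimately have "e' \<inter> verts \<Gamma> = {a, b}" using abe(5) by auto
    then show False using joins_unique[OF ab, of e'] e' unfolding joins_def by blast
  qed
  ultimately consider "a \<in> e\<^sub>3" "b \<in> e\<^sub>2" | "a \<in> e\<^sub>2" "b \<in> e\<^sub>3" using e d by blast
  then show thesis
  proof cases
    case 1
    then show ?thesis using triangle[OF E d ab] by blast
  next
    case 2
    then show ?thesis using triangle[of e\<^sub>1 e\<^sub>3 e\<^sub>2 a b] E d ab by (simp add: insert_commute)
  qed
qed

lemma card_face_vertices: "F \<in> faces \<Gamma> \<Longrightarrow> card (verts \<Gamma> \<inter> F) = 3"
  by (erule face_triangle) simp

lemma face_edge_ex:
  assumes F: "F \<in> faces \<Gamma>" and xy: "x \<in> verts \<Gamma> \<inter> F" "y \<in> verts \<Gamma> \<inter> F" "x \<noteq> y"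
  shows "\<exists>e. joins \<Gamma> e x y \<and> e \<subseteq> F"
proof -
  obtain a b c e\<^sub>1 e\<^sub>2 e\<^sub>3 where "verts \<Gamma> \<inter> F = {a, b, c}"
    and e: "e\<^sub>1 \<subseteq> F" "e\<^sub>2 \<subseteq> F" "e\<^sub>3 \<subseteq> F" "joins \<Gamma> e\<^sub>1 a b" "joins \<Gamma> e\<^sub>2 b c" "joins \<Gamma> e\<^sub>3 c a"
    using face_triangle[OF F] by metis
  then have "x \<in> {a, b, c}" "y \<in> {a, b, c}" using xy by auto
  then show ?thesis using e joins_sym xy(3) by (elim insertE emptyE) metis+
qed

text \<open>\<open>F\<close> contains an edge between \<open>x\<close> and \<open>y\<close>, and in
  a simple graph there is only one.\<close>

lemma joins_subset_face:
  assumes "F \<in> faces \<Gamma>" "joins \<Gamma> e x y" "x \<in> F" "y \<in> F"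
  shows "e \<subseteq> F"
proof -
  have "x \<in> verts \<Gamma> \<inter> F" "y \<in> verts \<Gamma> \<inter> F" using assms unfolding joins_def by blast+
  then show ?thesis using face_edge_ex joins_unique joins_distinct assms by metis
qed

lemma oriented_edges_face:
  assumes "F \<in> faces \<Gamma>"
  shows "oriented_edges \<Gamma> F = ordered_pairs (verts \<Gamma> \<inter> F)"
  using face_edge_ex[OF assms] joins_mem joins_distinct
  unfolding oriented_edges_def ordered_pairs_def by fastforce

lemma edge_in_two_faces:
  assumes F: "F \<in> faces \<Gamma>" "F' \<in> faces \<Gamma>" "F \<noteq> F'" and e: "e \<in> edges \<Gamma>" "e \<subseteq> F" "e \<subseteq> F'"
  shows "e = F \<inter> F'"
proof -
  obtain x y where "x \<noteq> y" "e \<inter> verts \<Gamma> = {x, y}" using edge_ends[OF e(1)] by metis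
  then have xy: "x \<in> F \<inter> F'" "y \<in> F \<inter> F'" "x \<noteq> y" using e(2,3) by blast+
  then have "F \<inter> F' \<in> edges \<Gamma>" using faces_Int[OF F] by (metis empty_iff singletonD)
  then show ?thesis using edge_subset_eq e by simp
qed

text \<open>Distinct faces with the same vertices would share two edges, but each of these equals
  the intersection of the faces. Hence a face may be replaced by its vertex set.\<close>

lemma face_vertices_inj:
  assumes F: "F \<in> faces \<Gamma>" "F' \<in> faces \<Gamma>" "verts \<Gamma> \<inter> F = verts \<Gamma> \<inter> F'"
  shows "F = F'"
proof (rule ccontr)
  assume ne: "F \<noteq> F'"
  obtain a b c e\<^sub>1 e\<^sub>2 e\<^sub>3 where abc: "verts \<Gamma> \<inter> F = {a, b, c}" "a \<noteq> b" "b \<noteq> c" "a \<noteq> c"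
    "e\<^sub>1 \<subseteq> F" "e\<^sub>2 \<subseteq> F" "joins \<Gamma> e\<^sub>1 a b" "joins \<Gamma> e\<^sub>2 b c"
    using face_triangle[OF F(1)] by metis
  then have "a \<in> F'" "b \<in> F'" "c \<in> F'" using F(3) by blast+
  then have "e\<^sub>1 \<subseteq> F'" "e\<^sub>2 \<subseteq> F'" using joins_subset_face[OF F(2)] abc by blast+
  then have "e\<^sub>1 = e\<^sub>2"
    using edge_in_two_faces[OF F(1,2) ne, of e\<^sub>1] edge_in_two_faces[OF F(1,2) ne, of e\<^sub>2] abc
    unfolding joins_def by simp
  then have "{a, b} = {b, c}" using abc(7,8) unfolding joins_def by simp
  then show False using abc(2,4) by (simp add: doubleton_eq_iff)
qed

lemma other_face_ex1:
  assumes F: "F \<in> faces \<Gamma>" and e: "e \<in> edges \<Gamma>" "e \<subseteq> F"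
  shows "\<exists>!F'. F' \<in> faces \<Gamma> \<and> F' \<noteq> F \<and> e \<subseteq> F'"
proof -
  obtain A B where AB: "A \<noteq> B" "{F \<in> faces \<Gamma>. e \<subseteq> F} = {A, B}"
    using card_edge_faces[OF e(1)] by (auto simp: card_2_iff)
  then have "F = A \<or> F = B" using F e by blast
  then show ?thesis using AB by (elim disjE) (metis (mono_tags, lifting) insertCI insertE mem_Collect_eq singletonD)+
qed

text \<open>Containing two vertices amounts to containing the edge between them, so the two faces at
  an edge become the two triples at a pair of vertices.\<close>

sublocale closed_pseudosurface "(\<lambda>F. verts \<Gamma> \<inter> F) ` faces \<Gamma>"
proof
  have "finite (verts \<Gamma>)" using embedded by (simp add: embedded_simple_graph_def)
  then show "finite (\<Union>((\<lambda>F. verts \<Gamma> \<inter> F) ` faces \<Gamma>))" by (rule finite_subset[rotated]) blast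
next
  fix t assume "t \<in> (\<lambda>F. verts \<Gamma> \<inter> F) ` faces \<Gamma>"
  then show "card t = 3" using card_face_vertices by blast
next
  fix t x y assume t: "t \<in> (\<lambda>F. verts \<Gamma> \<inter> F) ` faces \<Gamma>" and xy: "x \<in> t" "y \<in> t" "x \<noteq> y"
  then obtain F where F: "F \<in> faces \<Gamma>" "t = verts \<Gamma> \<inter> F" by blast
  then obtain e where e: "joins \<Gamma> e x y" "e \<subseteq> F" using face_edge_ex xy by metis
  then have "e \<in> edges \<Gamma>" unfolding joins_def by blast
  then obtain F' where F': "F' \<in> faces \<Gamma>" "F' \<noteq> F" "e \<subseteq> F'"
    and uniq: "\<And>F''. F'' \<in> faces \<Gamma> \<Longrightarrow> F'' \<noteq> F \<Longrightarrow> e \<subseteq> F'' \<Longrightarrow> F'' = F'"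
    using other_face_ex1[OF F(1) _ e(2)] by metis
  show "\<exists>!t'. t' \<in> (\<lambda>F. verts \<Gamma> \<inter> F) ` faces \<Gamma> \<and> t' \<noteq> t \<and> x \<in> t' \<and> y \<in> t'"
  proof (rule ex1I[of _ "verts \<Gamma> \<inter> F'"])
    show "verts \<Gamma> \<inter> F' \<in> (\<lambda>F. verts \<Gamma> \<inter> F) ` faces \<Gamma> \<and> verts \<Gamma> \<inter> F' \<noteq> t
        \<and> x \<in> verts \<Gamma> \<inter> F' \<and> y \<in> verts \<Gamma> \<inter> F'"
      using F F' face_vertices_inj joins_mem[OF e(1) F'(3)] by blast
    fix t' assume t': "t' \<in> (\<lambda>F. verts \<Gamma> \<inter> F) ` faces \<Gamma> \<and> t' \<noteq> t \<and> x \<in> t' \<and> y \<in> t'"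
    then obtain F'' where F'': "F'' \<in> faces \<Gamma>" "t' = verts \<Gamma> \<inter> F''" by blast
    then have "e \<subseteq> F''" using t' joins_subset_face[OF F''(1) e(1)] by blast
    then show "t' = verts \<Gamma> \<inter> F'" using uniq[OF F''(1)] F'' F(2) t' by blast
  qed
qed

text \<open>Two consecutive edges of a zigzag span the three vertices of a face, and consecutive
  faces differ exactly when the vertices three steps apart do.\<close>

lemma zigzag_iff: "zigzag \<Gamma> Z \<longleftrightarrow> (\<exists>v. strip v \<and> Z = vertex_walk_edges v)"
proof
  assume "zigzag \<Gamma> Z"
  then obtain e v where z: "zigzag_edges \<Gamma> e" and j: "\<And>i. joins \<Gamma> (e i) (v i) (v (i + 1))"
    and Z: "\<And>i. Z i = (v i, v (i + 1))"
    unfolding zigzag_def by blast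
  have adj: "adjacent \<Gamma> (e i) (e (Suc i))" for i using z unfolding zigzag_edges_def by simp
  have d: "v i \<noteq> v (Suc i)" "v i \<noteq> v (Suc (Suc i))" for i
  proof -
    show "v i \<noteq> v (Suc i)" using joins_distinct j[of i] by simp
    show "v i \<noteq> v (Suc (Suc i))"
      using joins_unique[of "e i" "v i" "v (Suc i)" "e (Suc i)"] j[of i] joins_sym[OF j[of "Suc i"]] adj[of i]
      unfolding adjacent_def by auto
  qed
  have "\<exists>F. F \<in> faces \<Gamma> \<and> e i \<union> e (Suc i) \<subseteq> F" for i using adj unfolding adjacent_def by blast
  then obtain F where F: "\<And>i. F i \<in> faces \<Gamma>" "\<And>i. e i \<union> e (Suc i) \<subseteq> F i" by metis
  have VF: "verts \<Gamma> \<inter> F i = {v i, v (Suc i), v (Suc (Suc i))}" for i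
    using joins_mem[OF j[of i], of "F i"] joins_mem[OF j[of "Suc i"], of "F i"] F[of i] d[of i] d[of "Suc i"]
    by (intro triangle_eq) auto
  have "strip v" unfolding strip_def
  proof (intro allI conjI)
    fix i
    show "{v i, v (Suc i), v (Suc (Suc i))} \<in> (\<lambda>F. verts \<Gamma> \<inter> F) ` faces \<Gamma>"
      using imageI[OF F(1)[of i], of "\<lambda>F. verts \<Gamma> \<inter> F"] unfolding VF .
    have "\<forall>G\<in>faces \<Gamma>. \<forall>G'\<in>faces \<Gamma>.
        e i \<union> e (Suc i) \<subseteq> G \<and> e (Suc i) \<union> e (Suc (Suc i)) \<subseteq> G' \<longrightarrow> G \<noteq> G'"
      using z unfolding zigzag_edges_def Suc_eq_plus1[symmetric] add_2_eq_Suc' by blast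
    then have "F i \<noteq> F (Suc i)" using F[of i] F[of "Suc i"] by blast
    then have "verts \<Gamma> \<inter> F i \<noteq> verts \<Gamma> \<inter> F (Suc i)" using face_vertices_inj F(1) by blast
    then show "v i \<noteq> v (Suc (Suc (Suc i)))" unfolding VF by auto
  qed
  moreover have "Z = vertex_walk_edges v" using Z by (simp add: vertex_walk_edges_def fun_eq_iff)
  ultimately show "\<exists>v. strip v \<and> Z = vertex_walk_edges v" by blast
next
  assume "\<exists>v. strip v \<and> Z = vertex_walk_edges v"
  then obtain v where v: "strip v" and Z: "Z = vertex_walk_edges v" by blast
  have d: "v i \<noteq> v (Suc i)" "v i \<noteq> v (Suc (Suc i))" "v i \<noteq> v (Suc (Suc (Suc i)))" for i
    using strip_distinct[OF v] by blast+
  have "\<exists>F. F \<in> faces \<Gamma> \<and> verts \<Gamma> \<inter> F = {v i, v (Suc i), v (Suc (Suc i))}" for i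
    using v unfolding strip_def by (metis (no_types, lifting) imageE)
  then obtain F where F: "\<And>i. F i \<in> faces \<Gamma>"
    "\<And>i. verts \<Gamma> \<inter> F i = {v i, v (Suc i), v (Suc (Suc i))}" by metis
  have mem: "v i \<in> verts \<Gamma> \<inter> F i" "v (Suc i) \<in> verts \<Gamma> \<inter> F i" "v (Suc (Suc i)) \<in> verts \<Gamma> \<inter> F i" for i
    using F(2)[of i] by blast+
  have "\<exists>e. joins \<Gamma> e (v i) (v (Suc i)) \<and> e \<subseteq> F i" for i
    using face_edge_ex[OF F(1) mem(1,2)] d by blast
  then obtain e where e: "\<And>i. joins \<Gamma> (e i) (v i) (v (Suc i))" "\<And>i. e i \<subseteq> F i" by metis
  have e': "e (Suc i) \<subseteq> F i" for i using joins_subset_face[OF F(1) e(1)] mem by blast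
  have ends: "e i \<inter> verts \<Gamma> = {v i, v (Suc i)}" "e i \<in> edges \<Gamma>" for i
    using e(1) unfolding joins_def by blast+
  have "adjacent \<Gamma> (e i) (e (Suc i))" for i
  proof -
    have "e i \<noteq> e (Suc i)"
    proof
      assume "e i = e (Suc i)"
      then have "{v i, v (Suc i)} = {v (Suc i), v (Suc (Suc i))}" using ends by metis
      then show False using d(2)[of i] d(1)[of i] by (simp add: doubleton_eq_iff)
    qed
    moreover have "v (Suc i) \<in> verts \<Gamma> \<and> v (Suc i) \<in> e i \<and> v (Suc i) \<in> e (Suc i)"
      using ends(1)[of i] ends(1)[of "Suc i"] by blast
    ultimately show ?thesis using ends(2)[of i] ends(2)[of "Suc i"] F(1)[of i] e(2)[of i] e'[of i]
      unfolding adjacent_def by blast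
  qed
  moreover have "G \<noteq> G'" if G: "G \<in> faces \<Gamma>" "G' \<in> faces \<Gamma>" "e i \<union> e (Suc i) \<subseteq> G" "e (Suc i) \<union> e (Suc (Suc i)) \<subseteq> G'"
    for i G G'
  \<comment> \<open>A common face would contain four distinct vertices.\<close>
  proof
    assume "G = G'"
    then have G4: "v i \<in> verts \<Gamma> \<inter> G" "v (Suc i) \<in> verts \<Gamma> \<inter> G" "v (Suc (Suc i)) \<in> verts \<Gamma> \<inter> G"
      "v (Suc (Suc (Suc i))) \<in> verts \<Gamma> \<inter> G"
      using G ends(1)[of i] ends(1)[of "Suc i"] ends(1)[of "Suc (Suc i)"] by blast+
    then have "verts \<Gamma> \<inter> G = {v i, v (Suc i), v (Suc (Suc i))}"
      using triangle_eq[OF imageI[OF G(1)] G4(1-3)] d by blast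
    then show False using G4(4) d by (metis empty_iff insert_iff)
  qed
  ultimately have "zigzag_edges \<Gamma> e" 
    unfolding zigzag_edges_def Suc_eq_plus1[symmetric] add_2_eq_Suc' by blast
  then show "zigzag \<Gamma> Z" unfolding zigzag_def using e(1) Z
    by (intro exI[of _ e] exI[of _ v]) (simp add: vertex_walk_edges_def)
qed

end

section \<open>The classification\<close>

theorem theorem2:
  fixes \<Gamma> :: "('a::t2_space) embedded_graph" and F :: "'a set"
  assumes "surface_triangulation \<Gamma>" and "F \<in> faces \<Gamma>"
  defines "D \<equiv> face_rotation \<Gamma> F" and "M \<equiv> z_monodromy \<Gamma> F"
  shows "(M1 D M \<or> M2 D M \<or> M3 D M \<or> M4 D M \<or> M5 D M \<or> M6 D M \<or> M7 D M) \<and>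
    (locally_z_knotted \<Gamma> F \<longleftrightarrow> M1 D M \<or> M2 D M \<or> M3 D M \<or> M4 D M)"
proof -
  interpret triangulation \<Gamma> by unfold_locales (rule assms(1))
  let ?t = "verts \<Gamma> \<inter> F"
  interpret m: marked_pseudosurface "(\<lambda>F. verts \<Gamma> \<inter> F) ` faces \<Gamma>" ?t
    by unfold_locales (use assms(2) in blast)
  have \<Omega>: "oriented_edges \<Gamma> F = ordered_pairs ?t" using oriented_edges_face assms(2) .
  have D: "D = triangle_rotation ?t"
    unfolding D_def face_rotation_def triangle_rotation_def \<Omega> ..
  \<comment> \<open>At \<open>D e\<close> the preimage in \<open>z_monodromy\<close> is
    \<open>e\<close>, its zigzag is the strip from \<open>e\<close>, and its least index is
    \<open>return_time e\<close>.\<close>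
  have Ms: "M (triangle_rotation ?t e) = m.first_return e" if e: "e \<in> ordered_pairs ?t" for e
    using m.rotation(1)[OF e] unfolding M_def z_monodromy_def \<Omega> Let_def
    by (simp add: D[unfolded D_def] m.rotation_the_inverse[OF e] zigzag_iff
        m.strip_edges_unique[OF e, simplified] m.first_return_def m.return_time_def)
  interpret mt: marked_triangle_monodromy "(\<lambda>F. verts \<Gamma> \<inter> F) ` faces \<Gamma>" ?t M
  proof
    show "M e = e" if "e \<notin> ordered_pairs ?t" for e
      using that unfolding M_def z_monodromy_def \<Omega> by simp
  qed (rule Ms)
  have "face_zigzags \<Gamma> F = m.strip_class ` ordered_pairs ?t"
    unfolding m.strip_classes_eq[symmetric] face_zigzags_def \<Omega> zigzag_iff D[unfolded D_def] ..
  then have "locally_z_knotted \<Gamma> F \<longleftrightarrow> M1 D M \<or> M2 D M \<or> M3 D M \<or> M4 D M"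
    unfolding locally_z_knotted_def D using mt.two_strip_classes_iff by simp
  then show ?thesis using mt.monodromy_cases unfolding D by blast
qed

end
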